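(* Let $p$ be a prime and let $A\subset \mathbb{F}_p$ be a nonempty set with $|A|<p^{1/2}$. Then $$|A(A+1)|\ge |A|^{106/105+o(1)},$$ where $o(1)$ denotes a quantity tending to $0$ as $|A|\to\infty$, uniformly in $p$.
   Context: $\mathbb{F}_p$ is the field with $p$ elements. For sets $X,Y\subset \mathbb{F}_p$, $XY=\{xy: x\in X, y\in Y\}$ and $X+1=\{x+1: x\in X\}$; thus $A(A+1)=\{a(b+1): a,b\in A\}$. *)

theory Defs
  imports Complex_Main "HOL-Algebra.AbelCoset" "HOL-Number_Theory.Residues"
begin

text \<open>The field of \<open>p\<close> elements. It is the value of a term, not a type, so that a bound
  can be stated uniformly over all primes.\<close>

abbreviation prime_field :: "nat \<Rightarrow> int ring" (\<open>\<F>\<close>) where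
  "prime_field p \<equiv> residue_ring (int p)"

end

theory Submission
  imports Defs "HOL-Analysis.Convex" "HOL-Real_Asymp.Real_Asymp"
begin

text \<open>
  Let \<open>B = A + 1\<close>, \<open>N = |A|\<close> and \<open>|AB| = K N\<close>; we may drop \<open>0\<close> and \<open>-1\<close> from \<open>A\<close>. Plunnecke's inequality gives
  \<open>|AA| \<le> 4 K\<^sup>2 N\<close>. If \<open>y\<close> lies in \<open>bB \<inter> b'B\<close> then \<open>b - b' = (y - b') - (y - b)\<close> with both terms in \<open>AA\<close>, so the
  differences of pairs with a large \<open>bB \<inter> b'B\<close> form a small set. Dependent random choice over \<open>y\<close> in \<open>AB\<close>
  yields \<open>V \<subseteq> A\<close> with \<open>|V|\<close> of order at least \<open>N / K\<close>, in which almost all pairs are of this kind; hence \<open>|V - V|\<close> is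
  of order at most \<open>K\<^bsup>12\<^esup> |V|\<close>.

  Thus \<open>V\<close> is structured both additively and multiplicatively, which the pivot argument of Glibichuk, Konyagin,
  Garaev, Katz and Shen excludes. Some dilate \<open>cV\<close> meets \<open>aV\<close> in at least \<open>t\<close> points for all \<open>a\<close> in a subset \<open>V1\<close>.
  As the field is prime, there is a quotient \<open>\<xi> = (a - b) / (c - d)\<close> of differences of \<open>V1\<close> such that either
  \<open>\<xi> + 1\<close> is not such a quotient, or \<open>V1 - \<xi> V1\<close> has nearly \<open>|V1|\<^sup>2\<close> elements. On the other hand most of \<open>aV1\<close>
  is covered by few translates of \<open>cV\<close>, so that \<open>V1 - \<xi> V1\<close> is essentially covered by few translates of a dilate
  of \<open>V + V - V - V\<close>. The coverings use only almost all differences instead of the full set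
  \<open>V - V\<close>; this saving leads to \<open>N \<le> C K\<^bsup>103\<^esup> log\<^sup>6 N\<close>, which is better than needed.
\<close>

subsection \<open>A weighted Plunnecke inequality\<close>

definition ims :: "('a \<Rightarrow> 'b \<Rightarrow> 'c) \<Rightarrow> 'a set \<Rightarrow> 'b set \<Rightarrow> 'c set" where
  "ims f X Y = (\<lambda>(x, y). f x y) ` (X \<times> Y)"

lemma ims_iff: "z \<in> ims f X Y \<longleftrightarrow> (\<exists>x\<in>X. \<exists>y\<in>Y. z = f x y)"
  by (auto simp: ims_def)

lemma imsI: "x \<in> X \<Longrightarrow> y \<in> Y \<Longrightarrow> f x y \<in> ims f X Y"
  by (auto simp: ims_def)

lemma imsE:
  assumes "z \<in> ims f X Y" obtains x y where "x \<in> X" "y \<in> Y" "z = f x y"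
  using assms by (auto simp: ims_def)

lemma finite_ims [simp, intro]: "finite X \<Longrightarrow> finite Y \<Longrightarrow> finite (ims f X Y)"
  by (simp add: ims_def)

lemma ims_mono: "X \<subseteq> X' \<Longrightarrow> Y \<subseteq> Y' \<Longrightarrow> ims f X Y \<subseteq> ims f X' Y'"
  by (auto simp: ims_def)

lemma ims_empty [simp]: "ims f {} Y = {}" "ims f X {} = {}"
  by (auto simp: ims_def)

lemma ims_insert_right: "ims f X (insert c C) = ims f X C \<union> (\<lambda>x. f x c) ` X"
  by (auto simp: ims_def)

lemma ims_Un_left: "ims f (X \<union> X') Y = ims f X Y \<union> ims f X' Y"
  by (auto simp: ims_def)

locale comm_cancel =
  fixes S :: "'a set" and f :: "'a \<Rightarrow> 'a \<Rightarrow> 'a"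
  assumes closed: "x \<in> S \<Longrightarrow> y \<in> S \<Longrightarrow> f x y \<in> S"
    and assoc: "x \<in> S \<Longrightarrow> y \<in> S \<Longrightarrow> z \<in> S \<Longrightarrow> f (f x y) z = f x (f y z)"
    and comm: "x \<in> S \<Longrightarrow> y \<in> S \<Longrightarrow> f x y = f y x"
    and cancel: "x \<in> S \<Longrightarrow> y \<in> S \<Longrightarrow> z \<in> S \<Longrightarrow> f x z = f y z \<Longrightarrow> x = y"
begin

lemma ims_closed: "X \<subseteq> S \<Longrightarrow> Y \<subseteq> S \<Longrightarrow> ims f X Y \<subseteq> S"
  by (auto simp: ims_def closed subset_iff)

lemma inj_on_translate: "X \<subseteq> S \<Longrightarrow> c \<in> S \<Longrightarrow> inj_on (\<lambda>x. f x c) X"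
  by (rule inj_onI) (meson cancel subsetD)

lemma card_translate: "X \<subseteq> S \<Longrightarrow> c \<in> S \<Longrightarrow> card ((\<lambda>x. f x c) ` X) = card X"
  by (rule card_image[OF inj_on_translate])

lemma right_comm: "x \<in> S \<Longrightarrow> y \<in> S \<Longrightarrow> z \<in> S \<Longrightarrow> f (f x y) z = f (f x z) y"
  by (metis assoc comm)

lemma card_ims_insert_le:
  assumes X: "finite X" "X \<subseteq> S" and B: "finite B" "B \<subseteq> S" and C: "finite C" "C \<subseteq> S" and c: "c \<in> S"
  defines "Z \<equiv> {x \<in> X. f x c \<in> ims f X C}"
  shows "card (ims f (ims f X B) (insert c C)) + card (ims f Z B)
    \<le> card (ims f (ims f X B) C) + card (ims f X B)"
proof -
  let ?T = "\<lambda>Y. (\<lambda>x. f x c) ` Y"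
  have ZX: "Z \<subseteq> X" by (auto simp: Z_def)
  have ZB: "ims f Z B \<subseteq> ims f X B" by (rule ims_mono[OF ZX order.refl])
  have XB: "ims f X B \<subseteq> S" using ims_closed X B by auto
  have sub: "?T (ims f Z B) \<subseteq> ims f (ims f X B) C"
  proof
    fix u assume "u \<in> ?T (ims f Z B)"
    then obtain z b where zb: "z \<in> Z" "b \<in> B" "u = f (f z b) c" by (auto simp: ims_iff)
    then obtain x c' where xc: "x \<in> X" "c' \<in> C" "f z c = f x c'" by (auto simp: Z_def ims_iff)
    have "u = f (f z c) b" using zb c X B ZX by (metis right_comm subsetD)
    also have "\<dots> = f (f x b) c'" using xc zb X B C by (metis right_comm subsetD)
    finally show "u \<in> ims f (ims f X B) C" using xc zb by (auto intro!: imsI)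
  qed
  have fin: "finite (ims f X B)" "finite (ims f Z B)" using X B finite_subset[OF ZX] by auto
  have "ims f (ims f X B) (insert c C) = ims f (ims f X B) C \<union> ?T (ims f X B - ims f Z B)"
    using sub by (auto simp: ims_insert_right)
  then have "card (ims f (ims f X B) (insert c C))
      \<le> card (ims f (ims f X B) C) + card (?T (ims f X B - ims f Z B))"
    by (simp add: card_Un_le)
  also have "card (?T (ims f X B - ims f Z B)) = card (ims f X B) - card (ims f Z B)"
    using XB c ZB fin by (subst card_translate) (auto simp: card_Diff_subset)
  finally show ?thesis using card_mono[OF fin(1) ZB] by linarith
qed

lemma card_ims_insert_eq:
  assumes X: "finite X" "X \<subseteq> S" and C: "finite C" "C \<subseteq> S" and c: "c \<in> S"
  shows "card (ims f X (insert c C)) + card {x \<in> X. f x c \<in> ims f X C} = card (ims f X C) + card X"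
proof -
  let ?Z = "{x \<in> X. f x c \<in> ims f X C}"
  have "ims f X (insert c C) = ims f X C \<union> (\<lambda>x. f x c) ` (X - ?Z)"
    by (auto simp: ims_insert_right)
  moreover have "card (\<dots>) = card (ims f X C) + card ((\<lambda>x. f x c) ` (X - ?Z))"
    using X C by (intro card_Un_disjoint) auto
  moreover have "card ((\<lambda>x. f x c) ` (X - ?Z)) = card X - card ?Z"
    using X c by (subst card_translate) (auto simp: card_Diff_subset)
  moreover have "card ?Z \<le> card X" using X by (intro card_mono) auto
  ultimately show ?thesis by simp
qed

text \<open>Petridis' induction is linear in the summand, so it survives weights. Weighting \<open>B1\<close> and \<open>B2\<close> by the
  inverses of their growth constants is what allows two different summands below.\<close>

lemma petridis_weighted:
  fixes h1 h2 \<kappa> :: real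
  assumes X: "finite X" "X \<subseteq> S" and B1: "finite B1" "B1 \<subseteq> S" and B2: "finite B2" "B2 \<subseteq> S"
    and h: "h1 \<ge> 0" "h2 \<ge> 0"
    and eq: "h1 * card (ims f X B1) + h2 * card (ims f X B2) = \<kappa> * card X"
    and min: "\<And>Z. Z \<subseteq> X \<Longrightarrow> \<kappa> * card Z \<le> h1 * card (ims f Z B1) + h2 * card (ims f Z B2)"
    and C: "finite C" "C \<subseteq> S"
  shows "h1 * card (ims f (ims f X B1) C) + h2 * card (ims f (ims f X B2) C) \<le> \<kappa> * card (ims f X C)"
  using C
proof (induction C rule: finite_induct)
  case empty then show ?case by simp
next
  case (insert c C)
  define Z where "Z = {x \<in> X. f x c \<in> ims f X C}"
  have c: "c \<in> S" and CS: "C \<subseteq> S" using insert by auto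
  have ge: "real (card (ims f (ims f X B) (insert c C)))
     \<le> card (ims f (ims f X B) C) + card (ims f X B) - real (card (ims f Z B))"
    if "finite B" "B \<subseteq> S" for B
    using card_ims_insert_le[OF X that insert(1) CS c] unfolding Z_def by linarith
  have eqc: "real (card (ims f X (insert c C))) = card (ims f X C) + card X - real (card Z)"
    using card_ims_insert_eq[OF X insert(1) CS c] unfolding Z_def by linarith
  have "h1 * card (ims f (ims f X B1) (insert c C)) + h2 * card (ims f (ims f X B2) (insert c C))
    \<le> h1 * (card (ims f (ims f X B1) C) + card (ims f X B1) - real (card (ims f Z B1)))
     + h2 * (card (ims f (ims f X B2) C) + card (ims f X B2) - real (card (ims f Z B2)))"
    by (intro add_mono mult_left_mono ge B1 B2 h)
  also have "\<dots> = (h1 * card (ims f (ims f X B1) C) + h2 * card (ims f (ims f X B2) C))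
      + \<kappa> * card X - (h1 * card (ims f Z B1) + h2 * card (ims f Z B2))"
    using eq by (simp add: algebra_simps)
  also have "\<dots> \<le> \<kappa> * card (ims f X C) + \<kappa> * card X - \<kappa> * card Z"
    using insert.IH[OF CS] min[of Z] by (auto simp: Z_def)
  also have "\<dots> = \<kappa> * card (ims f X (insert c C))"
    unfolding eqc by (simp add: algebra_simps)
  finally show ?case .
qed

lemma plunnecke_two:
  fixes \<alpha>1 \<alpha>2 :: real
  assumes X: "finite X" "X \<subseteq> S" "X \<noteq> {}" and B1: "finite B1" "B1 \<subseteq> S" and B2: "finite B2" "B2 \<subseteq> S"
    and a: "\<alpha>1 > 0" "\<alpha>2 > 0"
    and b1: "card (ims f X B1) \<le> \<alpha>1 * card X" and b2: "card (ims f X B2) \<le> \<alpha>2 * card X"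
  shows "\<exists>Y\<subseteq>X. Y \<noteq> {} \<and> card (ims f (ims f Y B1) B2) \<le> 4 * \<alpha>1 * \<alpha>2 * card Y"
proof -
  define w where "w Y = card (ims f Y B1) / \<alpha>1 + card (ims f Y B2) / \<alpha>2" for Y
  define r where "r Y = w Y / card Y" for Y
  let ?P = "{Y. Y \<subseteq> X \<and> Y \<noteq> {}}"
  have "finite ?P" "?P \<noteq> {}" using X by auto
  then have "finite (r ` ?P)" "r ` ?P \<noteq> {}" by blast+
  then obtain v where "v \<in> r ` ?P" and v: "\<not> (\<exists>x\<in>r ` ?P. x < v)"
    using ex_min_if_finite[of "r ` ?P"] by blast
  then obtain Y where Y: "Y \<in> ?P" "v = r Y" by blast
  have Ymin: "r Y \<le> r Z" if "Z \<in> ?P" for Z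
    using v that Y(2) by (meson image_eqI not_le)
  have fY: "finite Y" "Y \<subseteq> S" "Y \<noteq> {}" using Y X finite_subset by auto
  have cY: "card Y > 0" using fY by auto
  have cX: "card X > 0" using X by auto
  have "w X \<le> 2 * card X"
  proof -
    have "card (ims f X B1) / \<alpha>1 \<le> card X" "card (ims f X B2) / \<alpha>2 \<le> card X"
      using b1 b2 a by (simp_all add: field_simps)
    then show ?thesis by (simp add: w_def)
  qed
  then have "r X \<le> 2" using cX by (simp add: r_def field_simps)
  moreover have "r Y \<le> r X" using Ymin X by auto
  ultimately have r2: "r Y \<le> 2" by simp
  have r0: "r Y \<ge> 0" using a by (simp add: r_def w_def)
  have eq: "(1/\<alpha>1) * card (ims f Y B1) + (1/\<alpha>2) * card (ims f Y B2) = r Y * card Y"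
    using cY by (simp add: r_def w_def)
  have mn: "r Y * card Z \<le> (1/\<alpha>1) * card (ims f Z B1) + (1/\<alpha>2) * card (ims f Z B2)" if "Z \<subseteq> Y" for Z
  proof (cases "Z = {}")
    case False
    then have "r Y \<le> r Z" using that Y by (intro Ymin) auto
    moreover have "card Z > 0" using that fY False finite_subset by fastforce
    ultimately show ?thesis by (simp add: r_def[of Z] w_def field_simps)
  qed auto
  have "(1/\<alpha>1) * card (ims f (ims f Y B1) B2) + (1/\<alpha>2) * card (ims f (ims f Y B2) B2) \<le> r Y * card (ims f Y B2)"
    by (rule petridis_weighted[OF fY(1,2) B1 B2 _ _ eq mn B2]) (use a in auto)
  moreover have "(1/\<alpha>2) * card (ims f (ims f Y B2) B2) \<ge> 0" using a by simp
  ultimately have 1: "(1/\<alpha>1) * card (ims f (ims f Y B1) B2) \<le> r Y * card (ims f Y B2)" by linarith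
  have "(1/\<alpha>1) * card (ims f Y B1) \<ge> 0" using a by simp
  then have 2: "(1/\<alpha>2) * card (ims f Y B2) \<le> r Y * card Y" using eq by linarith
  have r2m: "c * (r Y * real n) \<le> c * (2 * real n)" if "c > 0" for c n
    using r2 that by (simp add: mult_right_mono)
  have "card (ims f (ims f Y B1) B2) \<le> \<alpha>1 * (r Y * card (ims f Y B2))"
    using 1 a by (simp add: field_simps)
  also have "\<dots> \<le> \<alpha>1 * (2 * real (card (ims f Y B2)))" by (rule r2m[OF a(1)])
  also have "\<dots> \<le> \<alpha>1 * (2 * (\<alpha>2 * (r Y * card Y)))"
    using 2 a by (intro mult_left_mono) (auto simp: field_simps)
  also have "\<dots> \<le> \<alpha>1 * (2 * (\<alpha>2 * (2 * real (card Y))))"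
    using r2m[OF a(2)] a by (intro mult_left_mono) auto
  finally have "card (ims f (ims f Y B1) B2) \<le> 4 * \<alpha>1 * \<alpha>2 * card Y" by (simp add: algebra_simps)
  then show ?thesis using Y(1) by (intro exI[of _ Y]) simp
qed

lemma plunnecke_two_large:
  fixes \<alpha>1 \<alpha>2 :: real
  assumes X: "finite X" "X \<subseteq> S" and B1: "finite B1" "B1 \<subseteq> S" and B2: "finite B2" "B2 \<subseteq> S"
    and a: "\<alpha>1 > 0" "\<alpha>2 > 0"
    and b1: "card (ims f X B1) \<le> \<alpha>1 * card X" and b2: "card (ims f X B2) \<le> \<alpha>2 * card X"
  shows "\<exists>U\<subseteq>X. card X \<le> 2 * card U \<and> card (ims f (ims f U B1) B2) \<le> 16 * \<alpha>1 * \<alpha>2 * card U"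
proof -
  define P where "P U \<longleftrightarrow> U \<subseteq> X \<and> card (ims f (ims f U B1) B2) \<le> 16 * \<alpha>1 * \<alpha>2 * card U" for U
  have "P {}" by (simp add: P_def)
  have "\<forall>U. P U \<longrightarrow> card U < Suc (card X)"
    using card_mono[OF X(1)] by (simp add: P_def less_Suc_eq_le)
  from ex_has_greatest_nat[of P, OF \<open>P {}\<close> this]
  obtain U where PU: "P U" and Umax: "\<forall>U'. P U' \<longrightarrow> card U' \<le> card U" by (elim exE conjE)
  have U: "U \<subseteq> X" "card (ims f (ims f U B1) B2) \<le> 16 * \<alpha>1 * \<alpha>2 * card U"
    using PU by (auto simp: P_def)
  have fU: "finite U" using U(1) X(1) by (rule finite_subset)
  have "card X \<le> 2 * card U"
  proof (rule ccontr)
    assume n: "\<not> ?thesis"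
    let ?X = "X - U"
    have cX: "card ?X = card X - card U" using U fU by (simp add: card_Diff_subset)
    have half: "real (card X) \<le> 2 * card ?X" using n cX by linarith
    have sub: "card (ims f ?X B) \<le> card (ims f X B)" if "finite B" for B
      using that X by (intro card_mono ims_mono) auto
    have le: "card (ims f ?X B) \<le> 2 * \<alpha> * card ?X"
      if "finite B" "card (ims f X B) \<le> \<alpha> * card X" "\<alpha> > 0" for B and \<alpha> :: real
    proof -
      have "real (card (ims f ?X B)) \<le> \<alpha> * card X" using sub[OF that(1)] that(2) by linarith
      also have "\<dots> \<le> \<alpha> * (2 * card ?X)" using half that(3) by (intro mult_left_mono) auto
      finally show ?thesis by simp
    qed
    have "card ?X > 0" using n cX by linarith
    then have "?X \<noteq> {}" by (metis card.empty less_irrefl)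
    have "\<exists>Y\<subseteq>?X. Y \<noteq> {} \<and> card (ims f (ims f Y B1) B2) \<le> 4 * (2 * \<alpha>1) * (2 * \<alpha>2) * card Y"
      by (rule plunnecke_two[OF _ _ _ B1 B2 _ _ le[OF B1(1) b1 a(1)] le[OF B2(1) b2 a(2)]])
        (use X a \<open>?X \<noteq> {}\<close> in auto)
    then obtain Y where Y: "Y \<subseteq> ?X" "Y \<noteq> {}"
      and Yc: "card (ims f (ims f Y B1) B2) \<le> 4 * (2 * \<alpha>1) * (2 * \<alpha>2) * card Y"
      by blast
    have fY: "finite Y" using Y X finite_subset by blast
    have cUY: "card (U \<union> Y) = card U + card Y" using Y fU fY by (intro card_Un_disjoint) auto
    have "real (card (ims f (ims f (U \<union> Y) B1) B2))
      \<le> card (ims f (ims f U B1) B2) + card (ims f (ims f Y B1) B2)"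
      unfolding ims_Un_left of_nat_add[symmetric] of_nat_le_iff by (rule card_Un_le)
    also have "\<dots> \<le> 16 * \<alpha>1 * \<alpha>2 * card (U \<union> Y)"
      using U Yc cUY by (simp add: algebra_simps)
    finally have "P (U \<union> Y)" using U Y by (auto simp: P_def)
    then have "card (U \<union> Y) \<le> card U" using Umax by blast
    then show False using cUY Y fY by auto
  qed
  then show ?thesis using U by blast
qed

end

subsection \<open>Double counting\<close>

lemma card_fibres_le:
  fixes k :: real
  assumes "finite T" "finite D" and D: "\<And>d. d \<in> D \<Longrightarrow> k \<le> card {t \<in> T. \<phi> t = d}"
  shows "k * card D \<le> card T"
proof -
  have "k * card D = (\<Sum>d\<in>D. k)" by simp
  also have "\<dots> \<le> (\<Sum>d\<in>D. real (card {t \<in> T. \<phi> t = d}))" by (rule sum_mono[OF D])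
  also have "\<dots> = real (\<Sum>d\<in>D. card {t \<in> T. \<phi> t = d})" by simp
  also have "(\<Sum>d\<in>D. card {t \<in> T. \<phi> t = d}) = card (\<Union>d\<in>D. {t \<in> T. \<phi> t = d})"
    using assms(1,2) by (subst card_UN_disjoint) auto
  also have "\<dots> \<le> card T" using assms(1) by (intro card_mono) auto
  finally show ?thesis by simp
qed

lemma card_sq_le_image:
  assumes X: "finite X"
  shows "(real (card X))\<^sup>2 \<le> real (card (g ` X)) * real (card {(x, y). x \<in> X \<and> y \<in> X \<and> g x = g y})"
proof -
  let ?c = "\<lambda>z. card {x \<in> X. g x = z}"
  have "X = (\<Union>z\<in>g ` X. {x \<in> X. g x = z})" by auto
  then have "card X = card (\<Union>z\<in>g ` X. {x \<in> X. g x = z})" by (rule arg_cong)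
  also have "\<dots> = (\<Sum>z\<in>g ` X. ?c z)"
    by (rule card_UN_disjoint) (use X in auto)
  finally have 1: "real (card X) = (\<Sum>z\<in>g ` X. real (?c z))" by simp
  have "{(x, y). x \<in> X \<and> y \<in> X \<and> g x = g y} = (\<Union>z\<in>g ` X. {x \<in> X. g x = z} \<times> {x \<in> X. g x = z})"
    by auto
  also have "card \<dots> = (\<Sum>z\<in>g ` X. ?c z * ?c z)"
    using X by (subst card_UN_disjoint) (auto simp: card_cartesian_product)
  finally have 2: "real (card {(x, y). x \<in> X \<and> y \<in> X \<and> g x = g y}) = (\<Sum>z\<in>g ` X. (real (?c z))\<^sup>2)"
    by (simp add: power2_eq_square)
  show ?thesis unfolding 1 2 mult.commute[of "real (card (g ` X))"] by (rule sum_squared_le_sum_of_squares)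
qed

lemma ruzsa_triangle:
  fixes X Y Z :: "'a::ab_group_add set"
  assumes "finite X" "finite Y" "finite Z"
  shows "card Z * card (ims (-) X Y) \<le> card (ims (-) X Z) * card (ims (-) Y Z)"
proof -
  let ?T = "ims (-) X Z \<times> ims (-) Y Z"
  have "real (card Z) * card (ims (-) X Y) \<le> card ?T"
  proof (rule card_fibres_le[where \<phi> = "\<lambda>(u, v). u - v"])
    fix d assume "d \<in> ims (-) X Y"
    then obtain x y where d: "x \<in> X" "y \<in> Y" "d = x - y" by (rule imsE)
    have "card Z = card ((\<lambda>z. (x - z, y - z)) ` Z)"
      by (rule card_image[symmetric]) (auto intro: inj_onI)
    also have "\<dots> \<le> card {t \<in> ?T. (case t of (u, v) \<Rightarrow> u - v) = d}"
      using assms d by (intro card_mono) (auto intro: imsI)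
    finally show "real (card Z) \<le> card {t \<in> ?T. (case t of (u, v) \<Rightarrow> u - v) = d}" by simp
  qed (use assms in auto)
  then show ?thesis by (simp add: card_cartesian_product flip: of_nat_mult)
qed

lemma dependent_choice:
  fixes \<Gamma> :: "'a \<Rightarrow> 'b set" and K l1 l2 :: real
  assumes A: "finite A" "A \<noteq> {}" and Y: "finite Y"
    and \<Gamma>: "\<And>b. b \<in> A \<Longrightarrow> \<Gamma> b \<subseteq> Y" "\<And>b. b \<in> A \<Longrightarrow> card (\<Gamma> b) = card A"
    and K: "K > 0" "card Y \<le> K * card A" and l: "l1 > 0" "l2 > 0"
  defines "bad \<equiv> \<lambda>(l::real) b b'. real (card (\<Gamma> b \<inter> \<Gamma> b')) < l * card A / K"
  shows "\<exists>V\<subseteq>A. (card A)\<^sup>2 \<le> 2 * K\<^sup>2 * (card V)\<^sup>2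
    \<and> card {(b, b'). b \<in> V \<and> b' \<in> V \<and> bad l1 b b'} \<le> 4 * l1 * (card V)\<^sup>2
    \<and> card {(b, b'). b \<in> V \<and> b' \<in> V \<and> bad l2 b b'} \<le> 4 * l2 * (card V)\<^sup>2"
proof -
  define N where "N = real (card A)"
  define V where "V y = {b \<in> A. y \<in> \<Gamma> b}" for y
  define B where "B l y = real (card {(b, b'). b \<in> V y \<and> b' \<in> V y \<and> bad l b b'})" for l y
  have N: "N > 0" using A by (simp add: N_def card_gt_0_iff)
  have YG: "{y \<in> Y. y \<in> \<Gamma> b} = \<Gamma> b" if "b \<in> A" for b using \<Gamma>(1)[OF that] by auto
  have "(\<Sum>y\<in>Y. card (V y)) = (\<Sum>b\<in>A. card A)"
    unfolding V_def using A Y YG \<Gamma>(2) by (intro sum_multicount_gen) auto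
  then have sumV: "(\<Sum>y\<in>Y. real (card (V y))) = N\<^sup>2"
    by (simp add: N_def power2_eq_square flip: of_nat_sum of_nat_mult)
  define E where "E = (\<Sum>y\<in>Y. (real (card (V y)))\<^sup>2)"
  have "(N\<^sup>2)\<^sup>2 \<le> E * card Y"
    using sum_squared_le_sum_of_squares[of "\<lambda>y. real (card (V y))" Y] by (simp add: sumV E_def)
  also have "\<dots> \<le> E * (K * N)"
    using K by (intro mult_left_mono) (auto simp: N_def E_def sum_nonneg)
  finally have E: "N ^ 3 / K \<le> E"
    using K N by (simp add: field_simps power2_eq_square power3_eq_cube)
  have badsum: "(\<Sum>y\<in>Y. B l y) \<le> l * E" if "l > 0" for l
  proof -
    let ?Q = "{q \<in> A \<times> A. bad l (fst q) (snd q)}"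
    have fQ: "finite ?Q" using A by auto
    have "{(b, b'). b \<in> V y \<and> b' \<in> V y \<and> bad l b b'} = {q \<in> ?Q. y \<in> \<Gamma> (fst q) \<inter> \<Gamma> (snd q)}" for y
      by (auto simp: V_def)
    then have "(\<Sum>y\<in>Y. B l y) = (\<Sum>y\<in>Y. real (card {q \<in> ?Q. y \<in> \<Gamma> (fst q) \<inter> \<Gamma> (snd q)}))"
      by (simp add: B_def)
    also have "\<dots> = real (\<Sum>q\<in>?Q. card (\<Gamma> (fst q) \<inter> \<Gamma> (snd q)))"
    proof -
      have "{y \<in> Y. y \<in> \<Gamma> (fst q) \<inter> \<Gamma> (snd q)} = \<Gamma> (fst q) \<inter> \<Gamma> (snd q)" if "q \<in> ?Q" for q
        using that \<Gamma>(1)[of "fst q"] by auto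
      then have "\<forall>q\<in>?Q. card {y \<in> Y. y \<in> \<Gamma> (fst q) \<inter> \<Gamma> (snd q)} = card (\<Gamma> (fst q) \<inter> \<Gamma> (snd q))"
        by simp
      from sum_multicount_gen[OF Y fQ this] show ?thesis by (simp flip: of_nat_sum)
    qed
    also have "\<dots> \<le> (\<Sum>q\<in>?Q. l * N / K)"
      unfolding of_nat_sum by (rule sum_mono) (auto simp: bad_def N_def)
    also have "\<dots> \<le> (\<Sum>q\<in>A \<times> A. l * N / K)"
      using A that K N by (intro sum_mono2) auto
    also have "\<dots> = l * (N ^ 3 / K)"
      by (simp add: card_cartesian_product N_def power3_eq_cube)
    also have "\<dots> \<le> l * E" using E that by (intro mult_left_mono) auto
    finally show ?thesis .
  qed
  define h where "h y = (real (card (V y)))\<^sup>2 - B l1 y / (4 * l1) - B l2 y / (4 * l2)" for y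
  have "(\<Sum>y\<in>Y. h y) = E - (\<Sum>y\<in>Y. B l1 y) / (4 * l1) - (\<Sum>y\<in>Y. B l2 y) / (4 * l2)"
    by (simp add: h_def E_def sum_subtractf sum_divide_distrib)
  moreover have "(\<Sum>y\<in>Y. B l1 y) / (4 * l1) \<le> E / 4" "(\<Sum>y\<in>Y. B l2 y) / (4 * l2) \<le> E / 4"
    using badsum[OF l(1)] badsum[OF l(2)] l by (simp_all add: field_simps)
  ultimately have hsum: "(\<Sum>y\<in>Y. h y) \<ge> N ^ 3 / (2 * K)" using E by simp
  have "\<exists>y\<in>Y. h y \<ge> N\<^sup>2 / (2 * K\<^sup>2)"
  proof (rule ccontr)
    assume "\<not> ?thesis"
    then have lt: "\<And>y. y \<in> Y \<Longrightarrow> h y < N\<^sup>2 / (2 * K\<^sup>2)" by force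
    have "Y \<noteq> {}" using A \<Gamma> N by (metis card.empty ex_in_conv subset_empty N_def of_nat_0 less_irrefl)
    then have "(\<Sum>y\<in>Y. h y) < (\<Sum>y\<in>Y. N\<^sup>2 / (2 * K\<^sup>2))" using Y lt by (intro sum_strict_mono) auto
    also have "\<dots> = card Y * (N\<^sup>2 / (2 * K\<^sup>2))" by simp
    also have "\<dots> \<le> (K * N) * (N\<^sup>2 / (2 * K\<^sup>2))" using K by (intro mult_right_mono) (auto simp: N_def)
    also have "\<dots> = N ^ 3 / (2 * K)" using K by (simp add: power2_eq_square power3_eq_cube)
    finally show False using hsum by simp
  qed
  then obtain y where y: "y \<in> Y" and hy: "h y \<ge> N\<^sup>2 / (2 * K\<^sup>2)" by blast
  have B0: "B l1 y / (4 * l1) \<ge> 0" "B l2 y / (4 * l2) \<ge> 0" using l by (simp_all add: B_def)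
  have N0: "N\<^sup>2 / (2 * K\<^sup>2) \<ge> 0" by simp
  have "N\<^sup>2 / (2 * K\<^sup>2) \<le> (real (card (V y)))\<^sup>2" using hy B0 by (simp add: h_def)
  then have 1: "N\<^sup>2 \<le> 2 * K\<^sup>2 * (card (V y))\<^sup>2" using K by (simp add: field_simps)
  have "B l1 y / (4 * l1) \<le> (real (card (V y)))\<^sup>2" "B l2 y / (4 * l2) \<le> (real (card (V y)))\<^sup>2"
    using hy B0 N0 unfolding h_def by linarith+
  then have "B l1 y \<le> 4 * l1 * (card (V y))\<^sup>2" "B l2 y \<le> 4 * l2 * (card (V y))\<^sup>2"
    using l by (simp_all add: field_simps)
  with 1 show ?thesis by (intro exI[of _ "V y"]) (auto simp: B_def N_def V_def)
qed

lemma card_high_degree_le: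
  fixes c :: real
  assumes V: "finite V" "V \<noteq> {}" and c: "c > 0"
    and R: "card {(v, w). v \<in> V \<and> w \<in> V \<and> R v w} \<le> c * (card V)\<^sup>2"
  shows "4 * card {v \<in> V. card {w \<in> V. R v w} > 4 * c * card V} \<le> card V"
proof -
  let ?H = "{v \<in> V. card {w \<in> V. R v w} > 4 * c * card V}"
  have m: "real (card V) > 0" using V by (simp add: card_gt_0_iff)
  have "(4 * c * card V) * card ?H = (\<Sum>v\<in>?H. 4 * c * card V)" by simp
  also have "\<dots> \<le> (\<Sum>v\<in>?H. real (card {w \<in> V. R v w}))" by (rule sum_mono) auto
  also have "\<dots> \<le> (\<Sum>v\<in>V. real (card {w \<in> V. R v w}))" using V by (intro sum_mono2) auto
  also have "\<dots> = card (SIGMA v:V. {w \<in> V. R v w})" using V by (subst card_SigmaI) auto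
  also have "(SIGMA v:V. {w \<in> V. R v w}) = {(v, w). v \<in> V \<and> w \<in> V \<and> R v w}" by auto
  also have "real (card \<dots>) \<le> (c * card V) * card V" using R by (simp add: power2_eq_square)
  finally have "(c * card V) * (4 * real (card ?H)) \<le> (c * card V) * real (card V)" by simp
  then have "4 * real (card ?H) \<le> real (card V)"
    by (rule mult_left_le_imp_le) (use c m in simp)
  then show ?thesis by linarith
qed

subsection \<open>Additive structure from a small shifted product set\<close>

text \<open>A finite subfield of a commutative ring whose unit \<open>e\<close> need not be the unit of the ring. All prime fields
  embed in this way into one and the same ring type. The induction rule says that the field is prime.\<close>

locale prime_subfield =
  fixes F :: "'a::comm_ring set" and e :: 'a
  assumes finite_F: "finite F"
    and zero_F: "0 \<in> F" and e_F: "e \<in> F" and e_nonzero: "e \<noteq> 0"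
    and add_F: "x \<in> F \<Longrightarrow> y \<in> F \<Longrightarrow> x + y \<in> F"
    and diff_F: "x \<in> F \<Longrightarrow> y \<in> F \<Longrightarrow> x - y \<in> F"
    and mult_F: "x \<in> F \<Longrightarrow> y \<in> F \<Longrightarrow> x * y \<in> F"
    and e_mult: "x \<in> F \<Longrightarrow> e * x = x"
    and inverse_F: "x \<in> F \<Longrightarrow> x \<noteq> 0 \<Longrightarrow> \<exists>y\<in>F. x * y = e"
    and induct_F: "0 \<in> R \<Longrightarrow> (\<And>x. x \<in> R \<Longrightarrow> x + e \<in> R) \<Longrightarrow> F \<subseteq> R"
begin

lemma mult_eq_0_F: "x \<in> F \<Longrightarrow> z \<in> F \<Longrightarrow> z \<noteq> 0 \<Longrightarrow> x * z = 0 \<Longrightarrow> x = 0"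
  by (metis e_mult inverse_F mult.assoc mult.commute mult_zero_left)

lemma mult_cancel_F:
  assumes "x \<in> F" "y \<in> F" "z \<in> F" "z \<noteq> 0" "x * z = y * z" shows "x = y"
  using mult_eq_0_F[of "x - y" z] assms by (simp add: diff_F left_diff_distrib)

sublocale units: comm_cancel "F - {0}" "(*)"
  by unfold_locales
    (auto simp: mult_F mult_ac dest: mult_eq_0_F intro: mult_cancel_F)

lemma inj_on_mult_F: "z \<in> F \<Longrightarrow> z \<noteq> 0 \<Longrightarrow> X \<subseteq> F \<Longrightarrow> inj_on ((*) z) X"
  by (rule inj_onI) (metis mult.commute mult_cancel_F subsetD)

lemma card_mult_F: "z \<in> F \<Longrightarrow> z \<noteq> 0 \<Longrightarrow> X \<subseteq> F \<Longrightarrow> card ((*) z ` X) = card X"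
  by (rule card_image[OF inj_on_mult_F])

lemma finite_sub_F: "X \<subseteq> F \<Longrightarrow> finite X"
  using finite_F finite_subset by blast

lemma card_prodset_self_le:
  fixes K :: real
  assumes A: "A \<subseteq> F - {0}" and B: "B \<subseteq> F - {0}" "B \<noteq> {}" and c: "card B = card A"
    and K: "K > 0" "card (ims (*) A B) \<le> K * card A"
  shows "card (ims (*) A A) \<le> 4 * K\<^sup>2 * card A"
proof -
  have fin: "finite A" "finite B" using A B finite_sub_F by blast+
  have "ims (*) B A = ims (*) A B" by (auto simp: ims_iff mult.commute) (metis mult.commute)+
  then have KB: "card (ims (*) B A) \<le> K * card B" using K c by simp
  obtain X where X: "X \<subseteq> B" "X \<noteq> {}" and Xc: "card (ims (*) (ims (*) X A) A) \<le> 4 * K * K * card X"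
    using units.plunnecke_two[OF fin(2) B fin(1) A fin(1) A K(1) K(1) KB KB] by blast
  then obtain x where x: "x \<in> X" by blast
  have xF: "x \<in> F" "x \<noteq> 0" using x X B by auto
  have fX: "finite X" using X fin finite_subset by blast
  have AA: "ims (*) A A \<subseteq> F" using units.ims_closed[OF A A] by blast
  have "card (ims (*) A A) = card ((*) x ` ims (*) A A)" using card_mult_F[OF xF AA] by simp
  also have "\<dots> \<le> card (ims (*) (ims (*) X A) A)"
  proof (rule card_mono)
    show "(*) x ` ims (*) A A \<subseteq> ims (*) (ims (*) X A) A"
      by (auto elim!: imsE simp: mult.assoc[symmetric] intro: imsI[OF imsI[OF x]])
  qed (use fX fin in auto)
  finally have "real (card (ims (*) A A)) \<le> 4 * K * K * card X" using Xc by linarith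
  also have "\<dots> \<le> 4 * K * K * card B" using card_mono[OF fin(2) X(1)] K by (intro mult_left_mono) auto
  finally show ?thesis using c by (simp add: power2_eq_square)
qed

lemma additive_structure:
  fixes K l :: real
  assumes A: "A \<subseteq> F" "0 \<notin> A" "\<And>a. a \<in> A \<Longrightarrow> a + e \<noteq> 0" "A \<noteq> {}"
    and K: "K > 0" "card (ims (*) A ((\<lambda>a. a + e) ` A)) \<le> K * card A"
    and AA: "card (ims (*) A A) \<le> 4 * K\<^sup>2 * card A" and l: "l > 0"
  shows "\<exists>V\<subseteq>A. \<exists>P. card A \<le> 4 * K * card V \<and> card (ims (-) V V) \<le> 2 ^ 25 * K ^ 12 * card V
    \<and> finite P \<and> card P \<le> 16 * K ^ 5 * card A / l
    \<and> (\<forall>v\<in>V. card {w \<in> V. v - w \<notin> P} \<le> 32 * l * card V \<and> card {w \<in> V. w - v \<notin> P} \<le> 32 * l * card V)"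
proof -
  define B where "B = (\<lambda>a. a + e) ` A"
  define N where "N = real (card A)"
  have fA: "finite A" using A finite_sub_F by blast
  have N: "N > 0" using A fA by (simp add: N_def card_gt_0_iff)
  have cB: "card B = card A" unfolding B_def by (rule card_image) (auto intro: inj_onI)
  have BF: "B \<subseteq> F" using A add_F e_F by (auto simp: B_def)
  have fB: "finite B" using BF finite_sub_F by blast
  define \<Gamma> where "\<Gamma> b = (*) b ` B" for b
  have \<Gamma>1: "\<Gamma> b \<subseteq> ims (*) A B" if "b \<in> A" for b using that by (auto simp: \<Gamma>_def intro: imsI)
  have \<Gamma>2: "card (\<Gamma> b) = card A" if "b \<in> A" for b
    unfolding \<Gamma>_def using that A BF cB by (subst card_mult_F) auto
  have f\<Gamma>: "finite (\<Gamma> b)" for b using fB by (simp add: \<Gamma>_def)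
  define bad where "bad = (\<lambda>(l::real) b b'. real (card (\<Gamma> b \<inter> \<Gamma> b')) < l * card A / K)"
  have bad_sym: "bad l b b' \<longleftrightarrow> bad l b' b" for l b b' by (simp add: bad_def Int_commute)
  define l1 :: real where "l1 = 1/64"
  have l1: "l1 > 0" by (simp add: l1_def)
  obtain V0 where V0: "V0 \<subseteq> A" and V0c: "(card A)\<^sup>2 \<le> 2 * K\<^sup>2 * (card V0)\<^sup>2"
    and b1: "card {(b, b'). b \<in> V0 \<and> b' \<in> V0 \<and> bad l1 b b'} \<le> 4 * l1 * (card V0)\<^sup>2"
    and b2: "card {(b, b'). b \<in> V0 \<and> b' \<in> V0 \<and> bad l b b'} \<le> 4 * l * (card V0)\<^sup>2"
    using dependent_choice[where \<Gamma> = \<Gamma>, OF fA A(4) finite_ims[OF fA fB] \<Gamma>1 \<Gamma>2 K[folded B_def] l1 l]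
    unfolding bad_def by blast
  have fV0: "finite V0" using V0 fA finite_subset by blast
  define m0 where "m0 = real (card V0)"
  have "N\<^sup>2 \<le> 2 * K\<^sup>2 * m0\<^sup>2" using V0c by (simp add: N_def m0_def)
  also have "\<dots> \<le> (2 * K * m0)\<^sup>2" by (simp add: power_mult_distrib)
  finally have Nm0: "N \<le> 2 * K * m0" by (rule power2_le_imp_le) (use K in \<open>simp add: m0_def\<close>)
  have m0: "m0 > 0" using N Nm0 K by (metis m0_def mult_zero_right of_nat_0_le_iff order_less_le linorder_not_less)
  have V0ne: "V0 \<noteq> {}" using m0 by (auto simp: m0_def)
  define H where "H l = {v \<in> V0. card {w \<in> V0. bad l v w} > 16 * l * m0}" for l
  have H: "4 * card (H l1) \<le> card V0" "4 * card (H l) \<le> card V0"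
    using card_high_degree_le[OF fV0 V0ne _ b1] card_high_degree_le[OF fV0 V0ne _ b2] l l1
    by (simp_all add: H_def m0_def)
  define V where "V = V0 - (H l1 \<union> H l)"
  have VV0: "V \<subseteq> V0" by (auto simp: V_def)
  have fV: "finite V" using VV0 fV0 finite_subset by blast
  have "card V \<ge> card V0 - card (H l1 \<union> H l)" unfolding V_def by (rule diff_card_le_card_Diff) (use fV0 in \<open>auto simp: H_def\<close>)
  moreover have "card (H l1 \<union> H l) \<le> card (H l1) + card (H l)" by (rule card_Un_le)
  ultimately have "card V0 \<le> 2 * card V" using H by linarith
  define m where "m = real (card V)"
  have m0m: "m0 \<le> 2 * m" "m \<le> m0" using \<open>card V0 \<le> 2 * card V\<close> card_mono[OF fV0 VV0] by (simp_all add: m0_def m_def)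
  have Vdeg: "card {w \<in> V0. bad k v w} \<le> 16 * k * m0" if "v \<in> V" "k = l1 \<or> k = l" for v k
    using that by (auto simp: V_def H_def)
  define P where "P k = {b - b' |b b'. b \<in> V0 \<and> b' \<in> V0 \<and> \<not> bad k b b'}" for k
  have PI: "b - b' \<in> P k" if "b \<in> V0" "b' \<in> V0" "\<not> bad k b b'" for b b' k using that by (auto simp: P_def)
  have P_sub: "P k \<subseteq> ims (-) V0 V0" for k by (auto simp: P_def intro: imsI)
  have fP: "finite (P k)" for k using P_sub fV0 finite_subset by blast
  have P_card: "card (P k) \<le> 16 * K ^ 5 * N / k" if k: "k > 0" for k
  proof -
    let ?T = "ims (*) A A \<times> ims (*) A A"
    have "(k * N / K) * card (P k) \<le> card ?T"
    proof (rule card_fibres_le[where \<phi> = "\<lambda>(u, v). u - v"])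
      fix d assume "d \<in> P k"
      then obtain b b' where b: "b \<in> V0" "b' \<in> V0" "\<not> bad k b b'" "d = b - b'" by (auto simp: P_def)
      have mem: "y - b \<in> ims (*) A A" if yb: "y \<in> \<Gamma> b" "b \<in> V0" for y b
      proof -
        obtain a where "a \<in> A" "y = b * (a + e)" using yb by (auto simp: \<Gamma>_def B_def)
        moreover have "b * e = b" using that V0 A e_mult by (metis mult.commute subsetD)
        ultimately have "y - b = b * a" by (simp add: distrib_left)
        then show ?thesis using \<open>a \<in> A\<close> that V0 by (auto intro: imsI)
      qed
      have "k * N / K \<le> card (\<Gamma> b \<inter> \<Gamma> b')" using b by (simp add: bad_def N_def)
      also have "card (\<Gamma> b \<inter> \<Gamma> b') = card ((\<lambda>y. (y - b', y - b)) ` (\<Gamma> b \<inter> \<Gamma> b'))"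
        by (rule card_image[symmetric]) (auto intro: inj_onI)
      also have "\<dots> \<le> card {t \<in> ?T. (case t of (u, v) \<Rightarrow> u - v) = d}"
        using fA b mem by (intro card_mono) auto
      finally show "k * N / K \<le> card {t \<in> ?T. (case t of (u, v) \<Rightarrow> u - v) = d}" by simp
    qed (use fA fP in auto)
    also have "card ?T = (real (card (ims (*) A A)))\<^sup>2" by (simp add: card_cartesian_product power2_eq_square)
    also have "\<dots> \<le> (4 * K\<^sup>2 * N)\<^sup>2" using AA by (intro power_mono) (simp_all add: N_def)
    finally have "k * N * card (P k) \<le> K * (4 * K\<^sup>2 * N)\<^sup>2"
      using K by (simp add: field_simps)
    also have "\<dots> = N * (16 * K ^ 5 * N)" by (simp add: power2_eq_square power_numeral_reduce)
    finally have "N * (k * card (P k)) \<le> N * (16 * K ^ 5 * N)" by (simp add: algebra_simps)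
    then have "k * card (P k) \<le> 16 * K ^ 5 * N" using N by (rule mult_left_le_imp_le)
    then show ?thesis using k by (simp add: field_simps)
  qed
  have VV: "card (ims (-) V V) \<le> 2 ^ 25 * K ^ 12 * m"
  proof -
    let ?T = "P l1 \<times> P l1"
    have "(m0 / 2) * card (ims (-) V V) \<le> card ?T"
    proof (rule card_fibres_le[where \<phi> = "\<lambda>(u, v). u - v"])
      fix d assume "d \<in> ims (-) V V"
      then obtain v v' where v: "v \<in> V" "v' \<in> V" "d = v - v'" by (rule imsE)
      let ?G = "V0 - ({w \<in> V0. bad l1 v w} \<union> {w \<in> V0. bad l1 v' w})"
      have "card V0 - card ({w \<in> V0. bad l1 v w} \<union> {w \<in> V0. bad l1 v' w}) \<le> card ?G"
        by (rule diff_card_le_card_Diff) (use fV0 in auto)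
      moreover have "card ({w \<in> V0. bad l1 v w} \<union> {w \<in> V0. bad l1 v' w})
        \<le> card {w \<in> V0. bad l1 v w} + card {w \<in> V0. bad l1 v' w}" by (rule card_Un_le)
      moreover have "card {w \<in> V0. bad l1 v w} \<le> m0 / 4" "card {w \<in> V0. bad l1 v' w} \<le> m0 / 4"
        using Vdeg[OF v(1), of l1] Vdeg[OF v(2), of l1] by (simp_all add: l1_def)
      ultimately have "m0 / 2 \<le> card ?G" unfolding m0_def by linarith
      also have "card ?G = card ((\<lambda>z. (v - z, v' - z)) ` ?G)"
        by (rule card_image[symmetric]) (auto intro: inj_onI)
      also have "\<dots> \<le> card {t \<in> ?T. (case t of (u, v) \<Rightarrow> u - v) = d}"
        using fP v VV0 by (intro card_mono) (auto intro!: PI)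
      finally show "m0 / 2 \<le> card {t \<in> ?T. (case t of (u, v) \<Rightarrow> u - v) = d}" by simp
    qed (use fP fV in auto)
    also have "card ?T = (real (card (P l1)))\<^sup>2" by (simp add: card_cartesian_product power2_eq_square)
    also have "\<dots> \<le> (1024 * K ^ 5 * N)\<^sup>2"
      using P_card[OF l1] by (intro power_mono) (simp_all add: l1_def)
    also have "\<dots> \<le> (1024 * K ^ 5 * (2 * K * m0))\<^sup>2"
      using Nm0 K N by (intro power_mono mult_left_mono) auto
    also have "\<dots> = (m0 / 2) * (2 ^ 23 * K ^ 12 * m0)" by (simp add: power2_eq_square power_numeral_reduce)
    finally have "card (ims (-) V V) \<le> 2 ^ 23 * K ^ 12 * m0"
      by (rule mult_left_le_imp_le) (use m0 in simp)
    also have "\<dots> \<le> 2 ^ 23 * K ^ 12 * (2 * m)" using m0m by (intro mult_left_mono) auto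
    also have "\<dots> \<le> 2 ^ 25 * K ^ 12 * m" using m0m m0 by simp
    finally show ?thesis .
  qed
  have deg: "card {w \<in> V. v - w \<notin> P l} \<le> 32 * l * m" "card {w \<in> V. w - v \<notin> P l} \<le> 32 * l * m" if "v \<in> V" for v
  proof -
    have v: "v \<in> V0" using that VV0 by blast
    have "{w \<in> V. v - w \<notin> P l} \<subseteq> {w \<in> V0. bad l v w}" "{w \<in> V. w - v \<notin> P l} \<subseteq> {w \<in> V0. bad l v w}"
      using PI[OF v, of _ l] PI[OF _ v, of _ l] bad_sym VV0 by blast+
    then have "card {w \<in> V. v - w \<notin> P l} \<le> card {w \<in> V0. bad l v w}"
      "card {w \<in> V. w - v \<notin> P l} \<le> card {w \<in> V0. bad l v w}"
      using fV0 by (auto intro!: card_mono)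
    moreover have "16 * l * m0 \<le> 32 * l * m" using m0m l by simp
    ultimately show "card {w \<in> V. v - w \<notin> P l} \<le> 32 * l * m" "card {w \<in> V. w - v \<notin> P l} \<le> 32 * l * m"
      using Vdeg[OF that, of l] by linarith+
  qed
  have "N \<le> 2 * K * (2 * m)" using Nm0 m0m K by (meson mult_left_mono order_trans less_imp_le mult_nonneg_nonneg zero_le_numeral)
  then have Nm: "N \<le> 4 * K * m" by simp
  show ?thesis
    by (intro exI[of _ V] exI[of _ "P l"] conjI ballI)
      (use VV0 V0 Nm VV fP P_card[OF l] deg in \<open>auto simp: N_def m_def\<close>)
qed

end

subsection \<open>A sum-product argument\<close>

lemma popular_level:
  fixes g :: "'a \<Rightarrow> nat" and S :: real
  assumes V: "finite V" and g: "\<And>a. a \<in> V \<Longrightarrow> g a \<le> n" and S: "S > 0" "S \<le> (\<Sum>a\<in>V. g a)"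
  shows "\<exists>t\<in>{1..n}. S \<le> (\<Sum>j = 1..n. 1 / real j) * (real t * real (card {a \<in> V. t \<le> g a}))"
proof (rule ccontr)
  let ?H = "\<Sum>j = 1..n. 1 / real j"
  let ?c = "\<lambda>t. card {a \<in> V. t \<le> g a}"
  assume "\<not> ?thesis"
  then have lt: "\<And>t. t \<in> {1..n} \<Longrightarrow> ?H * (real t * ?c t) < S" by force
  have "(\<Sum>a\<in>V. card {t \<in> {1..n}. t \<le> g a}) = (\<Sum>t\<in>{1..n}. ?c t)"
    using V by (intro sum_multicount_gen) auto
  moreover have "card {t \<in> {1..n}. t \<le> g a} = g a" if "a \<in> V" for a
  proof -
    have "{t \<in> {1..n}. t \<le> g a} = {1..g a}" using g[OF that] by auto
    then show ?thesis by simp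
  qed
  ultimately have eq: "(\<Sum>a\<in>V. g a) = (\<Sum>t\<in>{1..n}. ?c t)" by simp
  have n: "n \<ge> 1"
  proof (rule ccontr)
    assume "\<not> n \<ge> 1"
    then have "(\<Sum>a\<in>V. g a) = 0" using eq by simp
    then show False using S by simp
  qed
  have H: "?H > 0" using n by (intro sum_pos) auto
  have "real (\<Sum>a\<in>V. g a) = (\<Sum>t\<in>{1..n}. real (?c t))" using eq by simp
  also have "\<dots> < (\<Sum>t\<in>{1..n}. S / ?H * (1 / real t))"
  proof (rule sum_strict_mono)
    fix t assume t: "t \<in> {1..n}"
    then show "real (?c t) < S / ?H * (1 / real t)"
      using lt[OF t] H by (simp add: field_simps)
  qed (use n in auto)
  also have "\<dots> = S / ?H * ?H" by (rule sum_distrib_left[symmetric])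
  also have "\<dots> = S" using H by simp
  finally show False using S by simp
qed

lemma greedy_covering:
  fixes X W P :: "'a::ab_group_add set"
  assumes X: "finite X" and W: "finite W" "W \<noteq> {}" and P: "finite P"
    and few: "16 * card {(x, w). x \<in> X \<and> w \<in> W \<and> x - w \<notin> P} \<le> card X * card W"
  shows "\<exists>Z\<subseteq>P. card Z * card W \<le> 16 * card P \<and> 8 * card (X - ims (+) Z W) \<le> card X"
proof -
  define Q where "Q Z \<longleftrightarrow> Z \<subseteq> P \<and> card Z * (card X * card W) \<le> 16 * card P * card (X \<inter> ims (+) Z W)" for Z
  have "Q {}" by (simp add: Q_def)
  have "\<forall>Z. Q Z \<longrightarrow> card Z < Suc (card P)"
    using card_mono[OF P] by (simp add: Q_def less_Suc_eq_le)
  from ex_has_greatest_nat[of Q, OF \<open>Q {}\<close> this]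
  obtain Z where QZ: "Q Z" and Zmax: "\<forall>Z'. Q Z' \<longrightarrow> card Z' \<le> card Z" by (elim exE conjE)
  have Z: "Z \<subseteq> P" "card Z * (card X * card W) \<le> 16 * card P * card (X \<inter> ims (+) Z W)"
    using QZ by (auto simp: Q_def)
  have fZ: "finite Z" using Z(1) P by (rule finite_subset)
  define R where "R = X - ims (+) Z W"
  have fR: "finite R" using X by (simp add: R_def)
  have "8 * card R \<le> card X"
  proof (rule ccontr)
    assume n: "\<not> ?thesis"
    let ?g = "{(x, w). x \<in> R \<and> w \<in> W \<and> x - w \<in> P}"
    let ?b = "{(x, w). x \<in> X \<and> w \<in> W \<and> x - w \<notin> P}"
    have fb: "finite ?b" by (rule finite_subset[of _ "X \<times> W"]) (use X W in auto)
    have fg: "finite ?g" by (rule finite_subset[of _ "R \<times> W"]) (use fR W in auto)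
    have "card (R \<times> W) \<le> card (?g \<union> ?b)" using fb fg by (intro card_mono) (auto simp: R_def)
    also have "\<dots> \<le> card ?g + card ?b" by (rule card_Un_le)
    finally have 1: "card R * card W \<le> card ?g + card ?b" by (simp add: card_cartesian_product)
    have W0: "card W > 0" using W by (simp add: card_gt_0_iff)
    have "card X * card W < (8 * card R) * card W" using n W0 by (intro mult_strict_right_mono) auto
    then have "card X * card W < 8 * (card R * card W)" by (simp only: mult.assoc)
    then have g: "card X * card W < 16 * card ?g" using 1 few by linarith
    define c where "c z = card {x \<in> R. x - z \<in> W}" for z
    have "?g \<subseteq> (\<Union>z\<in>P. (\<lambda>x. (x, x - z)) ` {x \<in> R. x - z \<in> W})"
    proof
      fix q assume "q \<in> ?g"
      then obtain x w where q: "q = (x, w)" "x \<in> R" "w \<in> W" "x - w \<in> P" by auto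
      then have "q \<in> (\<lambda>x'. (x', x' - (x - w))) ` {x' \<in> R. x' - (x - w) \<in> W}" by (intro image_eqI[of _ _ x]) auto
      then show "q \<in> (\<Union>z\<in>P. (\<lambda>x. (x, x - z)) ` {x \<in> R. x - z \<in> W})" using q(4) by blast
    qed
    then have "card ?g \<le> card (\<Union>z\<in>P. (\<lambda>x. (x, x - z)) ` {x \<in> R. x - z \<in> W})"
      using P fR by (intro card_mono) auto
    also have "\<dots> \<le> (\<Sum>z\<in>P. card ((\<lambda>x. (x, x - z)) ` {x \<in> R. x - z \<in> W}))" by (rule card_UN_le[OF P])
    also have "\<dots> \<le> (\<Sum>z\<in>P. c z)" unfolding c_def using fR by (intro sum_mono card_image_le) auto
    finally have gc: "card ?g \<le> (\<Sum>z\<in>P. c z)" .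
    have "\<exists>z\<in>P. card X * card W \<le> 16 * card P * c z"
    proof (rule ccontr)
      assume "\<not> ?thesis"
      then have lt: "\<And>z. z \<in> P \<Longrightarrow> 16 * card P * c z \<le> card X * card W" by force
      have "card P > 0" using g gc by (cases "P = {}") (auto simp: P card_gt_0_iff)
      have "16 * card P * (\<Sum>z\<in>P. c z) = (\<Sum>z\<in>P. 16 * card P * c z)" by (rule sum_distrib_left)
      also have "\<dots> \<le> card P * (card X * card W)" using sum_bounded_above[of P, OF lt] by simp
      finally have "card P * (16 * (\<Sum>z\<in>P. c z)) \<le> card P * (card X * card W)" by (simp only: mult_ac)
      then have "16 * (\<Sum>z\<in>P. c z) \<le> card X * card W" using \<open>card P > 0\<close> by (simp only: nat_mult_le_cancel1)
      then show False using g gc by linarith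
    qed
    then obtain z where z: "z \<in> P" "card X * card W \<le> 16 * card P * c z" by blast
    have "card R \<le> card X" unfolding R_def using X by (intro card_mono) auto
    then have "card X * card W > 0" using n W0 by (intro mult_pos_pos) auto
    then have "c z > 0" using z(2) by (metis gr0I mult_0_right not_le)
    then obtain x where x: "x \<in> R" "x - z \<in> W" by (auto simp: c_def card_gt_0_iff)
    have "z \<notin> Z"
    proof
      assume "z \<in> Z"
      then have "z + (x - z) \<in> ims (+) Z W" using x by (intro imsI)
      then show False using x by (simp add: R_def)
    qed
    have sub: "{x \<in> R. x - z \<in> W} \<subseteq> X \<inter> ims (+) (insert z Z) W"
    proof
      fix x assume x: "x \<in> {x \<in> R. x - z \<in> W}"
      then have "z + (x - z) \<in> ims (+) (insert z Z) W" by (intro imsI) auto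
      then show "x \<in> X \<inter> ims (+) (insert z Z) W" using x by (simp add: R_def)
    qed
    have "card (X \<inter> ims (+) Z W) + c z = card (X \<inter> ims (+) Z W \<union> {x \<in> R. x - z \<in> W})"
      unfolding c_def using X fR by (intro card_Un_disjoint[symmetric]) (auto simp: R_def)
    also have "\<dots> \<le> card (X \<inter> ims (+) (insert z Z) W)"
      using X sub ims_mono[of Z "insert z Z" W W "(+)"] by (intro card_mono) auto
    finally have "16 * card P * (card (X \<inter> ims (+) Z W) + c z) \<le> 16 * card P * card (X \<inter> ims (+) (insert z Z) W)"
      by (rule mult_le_mono2)
    then have "card (insert z Z) * (card X * card W) \<le> 16 * card P * card (X \<inter> ims (+) (insert z Z) W)"
      using Z(2) z(2) \<open>z \<notin> Z\<close> fZ by (simp add: algebra_simps)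
    then have "Q (insert z Z)" using Z(1) z(1) by (simp add: Q_def)
    then have "card (insert z Z) \<le> card Z" using Zmax by blast
    then show False using \<open>z \<notin> Z\<close> fZ by simp
  qed
  show ?thesis
  proof (cases "card X = 0")
    case True
    then show ?thesis using X by (intro exI[of _ "{}"]) auto
  next
    case False
    have "card X * (card Z * card W) \<le> card X * (16 * card P)"
    proof -
      have "card (X \<inter> ims (+) Z W) \<le> card X" using X by (intro card_mono) auto
      then have "16 * card P * card (X \<inter> ims (+) Z W) \<le> 16 * card P * card X" by (rule mult_le_mono2)
      with Z(2) have "card Z * (card X * card W) \<le> 16 * card P * card X" by (rule order_trans)
      then show ?thesis by (simp only: mult_ac)
    qed
    then have "card Z * card W \<le> 16 * card P" using False by simp
    then show ?thesis using Z(1) \<open>8 * card R \<le> card X\<close> by (auto simp: R_def)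
  qed
qed

global_interpretation additive: comm_cancel UNIV "(+) :: 'a::ab_group_add \<Rightarrow> 'a \<Rightarrow> 'a"
  by unfold_locales (auto simp: add_ac)

lemma ims_plus_uminus: "ims (+) X (uminus ` Y) = ims (-) X (Y :: 'a::ab_group_add set)"
  by (force simp: ims_iff)

lemma card_double_difference_le:
  fixes V :: "'a::ab_group_add set" and \<sigma> :: real
  assumes V: "finite V" "V \<noteq> {}" and \<sigma>: "\<sigma> > 0" "card (ims (-) V V) \<le> \<sigma> * card V"
  shows "card (ims (-) (ims (+) V V) (ims (+) V V)) \<le> 16 * \<sigma> ^ 4 * card V"
proof -
  let ?D = "ims (-) (ims (+) V V) (ims (+) V V)"
  have s: "card (ims (+) V (uminus ` V)) \<le> \<sigma> * card V" using \<sigma> by (simp add: ims_plus_uminus)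
  obtain X where X: "X \<subseteq> V" "X \<noteq> {}"
    and Xc: "card (ims (+) (ims (+) X (uminus ` V)) (uminus ` V)) \<le> 4 * \<sigma> * \<sigma> * card X"
    using additive.plunnecke_two[OF V(1) subset_UNIV V(2) _ subset_UNIV _ subset_UNIV \<sigma>(1) \<sigma>(1) s s] V by auto
  have fX: "finite X" using X V finite_subset by blast
  have X0: "real (card X) > 0" using X fX by (simp add: card_gt_0_iff)
  have "ims (-) (ims (+) V V) X = uminus ` ims (+) (ims (+) X (uminus ` V)) (uminus ` V)"
    unfolding ims_plus_uminus
  proof (intro equalityI subsetI)
    fix z assume "z \<in> ims (-) (ims (+) V V) X"
    then obtain v w x where z: "v \<in> V" "w \<in> V" "x \<in> X" "z = v + w - x" by (auto elim!: imsE)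
    then have "x - v - w \<in> ims (-) (ims (-) X V) V" by (intro imsI)
    moreover have "z = - (x - v - w)" using z by simp
    ultimately show "z \<in> uminus ` ims (-) (ims (-) X V) V" by blast
  next
    fix z assume "z \<in> uminus ` ims (-) (ims (-) X V) V"
    then obtain v w x where z: "v \<in> V" "w \<in> V" "x \<in> X" "z = - (x - v - w)" by (auto elim!: imsE)
    then have "v + w - x \<in> ims (-) (ims (+) V V) X" by (intro imsI)
    moreover have "z = v + w - x" using z by simp
    ultimately show "z \<in> ims (-) (ims (+) V V) X" by simp
  qed
  then have "card (ims (-) (ims (+) V V) X) = card (ims (+) (ims (+) X (uminus ` V)) (uminus ` V))"
    by (simp add: card_image)
  then have c: "real (card (ims (-) (ims (+) V V) X)) \<le> 4 * \<sigma>\<^sup>2 * card X" using Xc by (simp add: power2_eq_square)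
  have "real (card X) * card ?D \<le> real (card (ims (-) (ims (+) V V) X)) * card (ims (-) (ims (+) V V) X)"
    using ruzsa_triangle[of "ims (+) V V" "ims (+) V V" X] V fX by (simp flip: of_nat_mult)
  also have "\<dots> \<le> (4 * \<sigma>\<^sup>2 * card X) * (4 * \<sigma>\<^sup>2 * card X)" using c by (intro mult_mono) auto
  also have "\<dots> = real (card X) * (16 * \<sigma> ^ 4 * card X)" by (simp add: power2_eq_square power4_eq_xxxx)
  finally have "card ?D \<le> 16 * \<sigma> ^ 4 * card X" using X0 by (rule mult_left_le_imp_le)
  also have "\<dots> \<le> 16 * \<sigma> ^ 4 * card V" using card_mono[OF V(1) X(1)] by (intro mult_left_mono) auto
  finally show ?thesis .
qed

context prime_subfield begin

lemma low_energy_dilate: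
  assumes V: "V \<subseteq> F" and small: "(card V)\<^sup>2 \<le> card F"
  shows "\<exists>\<xi>\<in>F. card {(q, q'). q \<in> V \<times> V \<and> q' \<in> V \<times> V \<and> fst q - \<xi> * snd q = fst q' - \<xi> * snd q'} \<le> 2 * (card V)\<^sup>2"
proof (rule ccontr)
  assume no: "\<not> ?thesis"
  let ?R = "\<lambda>\<xi> r. fst (fst r) - \<xi> * snd (fst r) = fst (snd r) - \<xi> * snd (snd r)"
  let ?Q = "(V \<times> V) \<times> (V \<times> V)"
  have fV: "finite V" using V finite_sub_F by blast
  have setq: "{(q, q'). q \<in> V \<times> V \<and> q' \<in> V \<times> V \<and> fst q - \<xi> * snd q = fst q' - \<xi> * snd q'} = {r \<in> ?Q. ?R \<xi> r}" for \<xi>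
    by auto
  have gt: "2 * (card V)\<^sup>2 < card {r \<in> ?Q. ?R \<xi> r}" if "\<xi> \<in> F" for \<xi>
    using no that unfolding setq by force
  have F0: "F \<noteq> {}" using zero_F by blast
  have fQ: "finite ?Q" using fV by auto
  have "card F * (2 * (card V)\<^sup>2) = (\<Sum>\<xi>\<in>F. 2 * (card V)\<^sup>2)" by simp
  also have "\<dots> < (\<Sum>\<xi>\<in>F. card {r \<in> ?Q. ?R \<xi> r})" using gt finite_F F0 by (intro sum_strict_mono) auto
  also have "\<dots> = (\<Sum>r\<in>?Q. card {\<xi> \<in> F. ?R \<xi> r})" by (rule sum_multicount_gen[OF finite_F fQ]) simp
  also have "\<dots> \<le> (\<Sum>r\<in>?Q. (if fst r = snd r then card F else 0) + 1)"
  proof (rule sum_mono)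
    fix r assume r: "r \<in> ?Q"
    obtain x y x' y' where rr: "r = ((x, y), (x', y'))" by (metis prod.collapse)
    have inF: "x \<in> F" "y \<in> F" "x' \<in> F" "y' \<in> F" using r rr V by auto
    show "card {\<xi> \<in> F. ?R \<xi> r} \<le> (if fst r = snd r then card F else 0) + 1"
    proof (cases "fst r = snd r")
      case True
      have "card {\<xi> \<in> F. ?R \<xi> r} \<le> card F" using finite_F by (intro card_mono) auto
      then show ?thesis using True by simp
    next
      case False
      have "\<xi> = \<eta>" if "\<xi> \<in> F" "?R \<xi> r" "\<eta> \<in> F" "?R \<eta> r" for \<xi> \<eta>
      proof -
        have 1: "\<xi> * (y - y') = x - x'" "\<eta> * (y - y') = x - x'" using that rr by (simp_all add: algebra_simps)
        have "y \<noteq> y'" using 1 False rr by auto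
        then show ?thesis using mult_cancel_F[of \<xi> \<eta> "y - y'"] 1 that inF diff_F by auto
      qed
      then have "card {\<xi> \<in> F. ?R \<xi> r} \<le> Suc 0" using finite_F by (subst card_le_Suc0_iff_eq) auto
      then show ?thesis by simp
    qed
  qed
  also have "\<dots> = card {r \<in> ?Q. fst r = snd r} * card F + card ?Q"
    unfolding sum.distrib sum.inter_filter[OF fQ, symmetric] by (simp only: sum_constant mult_1_right of_nat_id)
  also have "{r \<in> ?Q. fst r = snd r} = (\<lambda>q. (q, q)) ` (V \<times> V)" by auto
  also have "card \<dots> = card (V \<times> V)" by (rule card_image) (auto intro: inj_onI)
  also have "card (V \<times> V) * card F + card ?Q \<le> card F * (2 * (card V)\<^sup>2)"
  proof -
    have "card ?Q = (card V)\<^sup>2 * (card V)\<^sup>2" by (simp add: card_cartesian_product power2_eq_square)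
    also have "\<dots> \<le> card F * (card V)\<^sup>2" using small by (rule mult_le_mono1)
    finally show ?thesis by (simp add: card_cartesian_product power2_eq_square)
  qed
  finally show False by simp
qed

lemma pivot:
  assumes V: "V \<subseteq> F" and two: "card V \<ge> 2" and small: "(card V)\<^sup>2 \<le> card F"
  shows "\<exists>a\<in>V. \<exists>b\<in>V. \<exists>c\<in>V. \<exists>d\<in>V. \<exists>\<xi>\<in>F. c \<noteq> d \<and> \<xi> * (c - d) = a - b \<and>
    (\<forall>X\<subseteq>V. \<forall>Y\<subseteq>V. 3 * card V \<le> 4 * card X \<longrightarrow> 3 * card V \<le> 4 * card Y \<longrightarrow>
      real (card V) ^ 3 \<le> 64 * real (card (ims (-) V V)) * real (card (ims (-) X ((*) \<xi> ` Y))))"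
proof -
  define R where "R = {\<xi> \<in> F. \<exists>a\<in>V. \<exists>b\<in>V. \<exists>c\<in>V. \<exists>d\<in>V. c \<noteq> d \<and> \<xi> * (c - d) = a - b}"
  have fV: "finite V" using V finite_sub_F by blast
  define n where "n = real (card V)"
  have n: "n > 0" using two by (simp add: n_def)
  obtain u v where uv: "u \<in> V" "v \<in> V" "u \<noteq> v"
    using two fV by (metis One_nat_def card_le_Suc0_iff_eq not_less_eq_eq numeral_2_eq_2)
  have D: "n \<le> card (ims (-) V V)"
  proof -
    have "card V = card ((\<lambda>x. x - u) ` V)" by (rule card_image[symmetric]) (auto intro: inj_onI)
    also have "\<dots> \<le> card (ims (-) V V)" using fV uv by (intro card_mono) (auto intro: imsI)
    finally show ?thesis by (simp add: n_def)
  qed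
  have "\<exists>\<xi>\<in>R. \<forall>X\<subseteq>V. \<forall>Y\<subseteq>V. 3 * card V \<le> 4 * card X \<longrightarrow> 3 * card V \<le> 4 * card Y \<longrightarrow>
      n ^ 3 \<le> 64 * real (card (ims (-) V V)) * real (card (ims (-) X ((*) \<xi> ` Y)))"
  proof (cases "F \<subseteq> R")
    case True
    obtain \<xi> where \<xi>: "\<xi> \<in> F" and E: "card {(q, q'). q \<in> V \<times> V \<and> q' \<in> V \<times> V \<and>
        fst q - \<xi> * snd q = fst q' - \<xi> * snd q'} \<le> 2 * (card V)\<^sup>2"
      using low_energy_dilate[OF V small] by blast
    have "n ^ 3 \<le> 64 * real (card (ims (-) V V)) * real (card (ims (-) X ((*) \<xi> ` Y)))"
      if X: "X \<subseteq> V" "3 * card V \<le> 4 * card X" and Y: "Y \<subseteq> V" "3 * card V \<le> 4 * card Y" for X Y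
    proof -
      have fXY: "finite X" "finite Y" using X Y fV finite_subset by blast+
      let ?g = "\<lambda>q. fst q - \<xi> * snd q"
      have img: "?g ` (X \<times> Y) = ims (-) X ((*) \<xi> ` Y)" by (force simp: ims_iff)
      let ?E = "{(q, q'). q \<in> V \<times> V \<and> q' \<in> V \<times> V \<and> ?g q = ?g q'}"
      have fE: "finite ?E" by (rule finite_subset[of _ "(V \<times> V) \<times> (V \<times> V)"]) (use fV in auto)
      define T where "T = real (card (ims (-) X ((*) \<xi> ` Y)))"
      have T0: "T \<ge> 0" by (simp add: T_def)
      have xy: "3 / 4 * n \<le> card X" "3 / 4 * n \<le> card Y" using X Y by (simp_all add: n_def)
      have "(3 / 4 * n * (3 / 4 * n))\<^sup>2 \<le> (real (card X) * real (card Y))\<^sup>2"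
        using xy n by (intro power_mono mult_mono) auto
      also have "\<dots> = (real (card (X \<times> Y)))\<^sup>2" by (simp add: card_cartesian_product)
      also have "\<dots> \<le> T * real (card {(q, q'). q \<in> X \<times> Y \<and> q' \<in> X \<times> Y \<and> ?g q = ?g q'})"
        using card_sq_le_image[of "X \<times> Y" ?g] fXY unfolding img T_def by simp
      also have "\<dots> \<le> T * real (card ?E)"
        using X Y fE T0 by (intro mult_left_mono of_nat_mono card_mono) auto
      also have "\<dots> \<le> T * (2 * n\<^sup>2)"
      proof (rule mult_left_mono[OF _ T0])
        have "real (card ?E) \<le> real (2 * (card V)\<^sup>2)" using E by (rule of_nat_mono)
        then show "real (card ?E) \<le> 2 * n\<^sup>2" by (simp add: n_def)
      qed
      finally have "n\<^sup>2 * (81 / 256 * n\<^sup>2) \<le> n\<^sup>2 * (2 * T)" by (simp add: power2_eq_square algebra_simps)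
      then have "81 / 256 * n\<^sup>2 \<le> 2 * T" by (rule mult_left_le_imp_le) (use n in simp)
      then have "n\<^sup>2 \<le> 64 * T" using T0 by simp
      then have "n * n\<^sup>2 \<le> real (card (ims (-) V V)) * (64 * T)" using D n by (intro mult_mono) auto
      then show ?thesis by (simp add: T_def power3_eq_cube power2_eq_square mult_ac)
    qed
    then show ?thesis using \<xi> True by blast
  next
    case False
    have "0 \<in> R" using uv zero_F by (auto simp: R_def)
    then obtain \<xi> where \<xi>: "\<xi> \<in> R" and \<xi>1: "\<xi> + e \<notin> R" using induct_F[of R] False by blast
    have \<xi>F: "\<xi> \<in> F" using \<xi> by (simp add: R_def)
    have "n ^ 3 \<le> 64 * real (card (ims (-) V V)) * real (card (ims (-) X ((*) \<xi> ` Y)))"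
      if X: "X \<subseteq> V" "3 * card V \<le> 4 * card X" and Y: "Y \<subseteq> V" "3 * card V \<le> 4 * card Y" for X Y
    proof -
      have fXY: "finite X" "finite Y" using X Y fV finite_subset by blast+
      have xy: "3 / 4 * n \<le> card X" "3 / 4 * n \<le> card Y" using X Y by (simp_all add: n_def)
      have x0: "real (card X) > 0" using xy n by linarith
      have y0: "real (card Y) > 0" using xy n by linarith
      define Y' where "Y' = (*) \<xi> ` Y"
      have fY': "finite Y'" using fXY by (simp add: Y'_def)
      define S where "S = real (card (ims (-) X Y))"
      define T where "T = real (card (ims (-) X Y'))"
      have ne: "X \<noteq> {}" "Y \<noteq> {}" using x0 y0 by auto
      then have "ims (-) X Y \<noteq> {}" "ims (-) X Y' \<noteq> {}" by (auto simp: ims_def Y'_def)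
      then have ST: "S > 0" "T > 0" using fXY fY' by (auto simp: S_def T_def card_gt_0_iff)
      have "card (ims (+) X (uminus ` Y)) \<le> S / card X * card X"
        "card (ims (+) X (uminus ` Y')) \<le> T / card X * card X"
        using x0 by (simp_all add: ims_plus_uminus S_def T_def)
      then have "\<exists>U\<subseteq>X. card X \<le> 2 * card U \<and>
        card (ims (+) (ims (+) U (uminus ` Y)) (uminus ` Y')) \<le> 16 * (S / card X) * (T / card X) * card U"
        by (intro additive.plunnecke_two_large) (use fXY fY' ST x0 in auto)
      then obtain U where U: "U \<subseteq> X" "card X \<le> 2 * card U"
        and Uc: "card (ims (-) (ims (-) U Y) Y') \<le> 16 * (S / card X) * (T / card X) * card U"
        unfolding ims_plus_uminus by blast
      have fU: "finite U" using U fXY finite_subset by blast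
      have u0: "real (card U) > 0" using U x0 by linarith
      have inj: "inj_on (\<lambda>(u, y). u - y - \<xi> * y) (U \<times> Y)"
      proof (rule inj_onI, clarify)
        fix x y x' y' assume m: "x \<in> U" "x' \<in> U" "y \<in> Y" "y' \<in> Y" and eq: "x - y - \<xi> * y = x' - y' - \<xi> * y'"
        have mV: "x \<in> V" "x' \<in> V" "y \<in> V" "y' \<in> V" using m X Y U by auto
        have ey: "e * (y - y') = y - y'" using mV V diff_F e_mult by blast
        have "(\<xi> + e) * (y - y') = \<xi> * y - \<xi> * y' + (y - y')"
          using ey by (simp add: distrib_right right_diff_distrib[of \<xi>])
        also have "\<dots> = x - x'" using eq by (simp add: algebra_simps)
        finally have "(\<xi> + e) * (y - y') = x - x'" .
        then have "y = y'" using \<xi>1 mV \<xi>F e_F add_F by (force simp: R_def)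
        then show "x = x' \<and> y = y'" using eq by simp
      qed
      have "real (card U) * card Y = card (U \<times> Y)" by (simp add: card_cartesian_product)
      also have "card (U \<times> Y) = card ((\<lambda>(u, y). u - y - \<xi> * y) ` (U \<times> Y))" by (rule card_image[OF inj, symmetric])
      also have "\<dots> \<le> card (ims (-) (ims (-) U Y) Y')"
        using fU fXY fY' by (intro card_mono) (auto simp: Y'_def intro!: imsI)
      finally have "real (card U) * card Y \<le> real (card (ims (-) (ims (-) U Y) Y'))" by simp
      also have "\<dots> \<le> card U * (16 * S * T / (card X)\<^sup>2)" using Uc by (simp add: power2_eq_square mult_ac)
      finally have "card Y \<le> 16 * S * T / (card X)\<^sup>2" using u0 by (rule mult_left_le_imp_le)
      then have "real (card Y) * (real (card X))\<^sup>2 \<le> 16 * S * T" using x0 by (simp add: field_simps)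
      moreover have "(3 / 4 * n) * (3 / 4 * n)\<^sup>2 \<le> real (card Y) * (real (card X))\<^sup>2"
        using xy n by (intro mult_mono power_mono) auto
      ultimately have "27 / 64 * n ^ 3 \<le> 16 * S * T" by (simp add: power2_eq_square power3_eq_cube)
      moreover have "S * T \<le> card (ims (-) V V) * T"
        unfolding S_def using X Y fV ST by (intro mult_right_mono of_nat_mono card_mono ims_mono) auto
      moreover have "real (card (ims (-) V V)) * T \<ge> 0" using ST by simp
      ultimately have "n ^ 3 \<le> 64 * (card (ims (-) V V) * T)" by linarith
      then show ?thesis by (simp add: T_def Y'_def)
    qed
    then show ?thesis using \<xi> by blast
  qed
  then obtain \<xi> where \<xi>R: "\<xi> \<in> R" and bound: "\<forall>X\<subseteq>V. \<forall>Y\<subseteq>V. 3 * card V \<le> 4 * card X \<longrightarrow> 3 * card V \<le> 4 * card Y \<longrightarrow>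
      real (card V) ^ 3 \<le> 64 * real (card (ims (-) V V)) * real (card (ims (-) X ((*) \<xi> ` Y)))"
    unfolding n_def by (elim bexE)
  from \<xi>R obtain a b c d where "a \<in> V" "b \<in> V" "c \<in> V" "d \<in> V" "\<xi> \<in> F" "c \<noteq> d \<and> \<xi> * (c - d) = a - b"
    unfolding R_def by blast
  with bound show ?thesis
    by (intro bexI[of _ a] bexI[of _ b] bexI[of _ c] bexI[of _ d] bexI[of _ \<xi>]) (elim conjE, intro conjI)
qed

lemma dilate_difference_le:
  assumes V: "V \<subseteq> F" and c0: "c0 \<in> F" and abcd: "a \<in> F" "b \<in> F" "c \<in> F" "d \<in> F" "c \<noteq> d"
    and \<xi>: "\<xi> \<in> F" "\<xi> * (c - d) = a - b"
    and X: "X \<subseteq> F" "X \<subseteq> ims (+) (Z c) {x \<in> V. c * x \<in> (*) c0 ` V}" "X \<subseteq> ims (+) (Z d) {x \<in> V. d * x \<in> (*) c0 ` V}"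
    and Y: "Y \<subseteq> F" "Y \<subseteq> ims (+) (Z a) {x \<in> V. a * x \<in> (*) c0 ` V}" "Y \<subseteq> ims (+) (Z b) {x \<in> V. b * x \<in> (*) c0 ` V}"
    and Z: "finite (Z a)" "finite (Z b)" "finite (Z c)" "finite (Z d)"
  shows "card (ims (-) X ((*) \<xi> ` Y))
    \<le> card (Z a) * card (Z b) * card (Z c) * card (Z d) * card (ims (-) (ims (+) V V) (ims (+) V V))"
proof -
  let ?D = "ims (-) (ims (+) V V) (ims (+) V V)"
  let ?S = "ims (-) X ((*) \<xi> ` Y)"
  let ?T = "Z a \<times> Z b \<times> Z c \<times> Z d \<times> ?D"
  let ?h = "\<lambda>(za, zb, zc, zd, v). c * zc - d * zd - a * za + b * zb + c0 * v"
  have fV: "finite V" using V finite_sub_F by blast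
  have fT: "finite ?T" using Z fV by auto
  have split: "\<exists>z\<in>Z'. \<exists>v\<in>V. k * x = k * z + c0 * v"
    if "x \<in> ims (+) Z' {x \<in> V. k * x \<in> (*) c0 ` V}" for x k Z'
    using that by (force elim!: imsE simp: distrib_left)
  have "(*) (c - d) ` ?S \<subseteq> ?h ` ?T"
  proof
    fix s assume "s \<in> (*) (c - d) ` ?S"
    then obtain x y where xy: "x \<in> X" "y \<in> Y" and s: "s = (c - d) * (x - \<xi> * y)" by (auto elim!: imsE)
    obtain zc vc where 1: "zc \<in> Z c" "vc \<in> V" "c * x = c * zc + c0 * vc" using split xy X(2) by blast
    obtain zd vd where 2: "zd \<in> Z d" "vd \<in> V" "d * x = d * zd + c0 * vd" using split xy X(3) by blast
    obtain za va where 3: "za \<in> Z a" "va \<in> V" "a * y = a * za + c0 * va" using split xy Y(2) by blast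
    obtain zb vb where 4: "zb \<in> Z b" "vb \<in> V" "b * y = b * zb + c0 * vb" using split xy Y(3) by blast
    have "s = c * x - d * x - (\<xi> * (c - d)) * y" using s by (simp add: algebra_simps)
    also have "\<dots> = c * x - d * x - a * y + b * y" unfolding \<xi>(2) by (simp add: algebra_simps)
    also have "\<dots> = ?h (za, zb, zc, zd, (vc + vb) - (vd + va))"
      unfolding 1(3) 2(3) 3(3) 4(3) by (simp add: algebra_simps)
    finally have "s = ?h (za, zb, zc, zd, (vc + vb) - (vd + va))" .
    moreover have "(za, zb, zc, zd, (vc + vb) - (vd + va)) \<in> ?T" using 1 2 3 4 by (auto intro!: imsI)
    ultimately show "s \<in> ?h ` ?T" by (rule image_eqI)
  qed
  then have "card ((*) (c - d) ` ?S) \<le> card ?T"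
    using fT by (meson card_image_le card_mono finite_imageI order_trans)
  moreover have "?S \<subseteq> F" using X(1) Y(1) \<xi>(1) diff_F mult_F by (auto elim!: imsE simp: subset_iff)
  then have "card ((*) (c - d) ` ?S) = card ?S" using abcd diff_F by (intro card_mult_F) auto
  ultimately show ?thesis by (simp add: card_cartesian_product mult_ac)
qed

lemma exists_popular_dilate:
  fixes M :: real
  assumes V: "V \<subseteq> F - {0}" "V \<noteq> {}" and M: "M > 0" "card (ims (*) V V) \<le> M"
  shows "\<exists>c\<in>V. real (card V) ^ 3 / M \<le> (\<Sum>a\<in>V. card {x \<in> V. a * x \<in> (*) c ` V})"
proof (rule ccontr)
  assume no: "\<not> ?thesis"
  define m where "m = real (card V)"
  define f where "f c a = card {x \<in> V. a * x \<in> (*) c ` V}" for c a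
  have fV: "finite V" using V finite_sub_F by blast
  have m: "m > 0" using V fV by (simp add: m_def card_gt_0_iff)
  have lt: "(\<Sum>a\<in>V. real (f c a)) < m ^ 3 / M" if "c \<in> V" for c
    using no that by (force simp: f_def m_def)
  let ?g = "\<lambda>q. fst q * snd q"
  let ?E = "{(q, q'). q \<in> V \<times> V \<and> q' \<in> V \<times> V \<and> ?g q = ?g q'}"
  let ?S = "SIGMA c:V. SIGMA a:V. {x \<in> V. a * x \<in> (*) c ` V}"
  have "inj_on (\<lambda>(q, q'). (fst q', fst q, snd q)) ?E"
  proof (rule inj_onI)
    fix r r' assume r: "r \<in> ?E" "r' \<in> ?E"
      and eq: "(\<lambda>(q, q'). (fst q', fst q, snd q)) r = (\<lambda>(q, q'). (fst q', fst q, snd q)) r'"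
    obtain a x b y where rr: "r = ((a, x), (b, y))" by (metis prod.collapse)
    obtain a' x' b' y' where rr': "r' = ((a', x'), (b', y'))" by (metis prod.collapse)
    have same: "a' = a" "x' = x" "b' = b" using eq rr rr' by auto
    have mem: "b \<in> V" "y \<in> V" "y' \<in> V" using r rr rr' by auto
    have "a * x = b * y" "a * x = b * y'" using r rr rr' same by auto
    then have "y * b = y' * b" by (simp add: mult.commute)
    then have "y = y'" using mem V mult_cancel_F[of y y' b] by blast
    then show "r = r'" using rr rr' same by simp
  qed
  then have "card ?E = card ((\<lambda>(q, q'). (fst q', fst q, snd q)) ` ?E)" by (rule card_image[symmetric])
  also have "\<dots> \<le> card ?S" using fV by (intro card_mono) auto
  also have "\<dots> = (\<Sum>c\<in>V. \<Sum>a\<in>V. f c a)" using fV by (simp add: f_def card_SigmaI)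
  finally have E: "real (card ?E) \<le> (\<Sum>c\<in>V. \<Sum>a\<in>V. real (f c a))"
    by (simp flip: of_nat_sum)
  have img: "?g ` (V \<times> V) = ims (*) V V" by (force simp: ims_iff)
  have "(m * m)\<^sup>2 \<le> real (card (ims (*) V V)) * real (card ?E)"
    using card_sq_le_image[of "V \<times> V" ?g] fV unfolding img by (simp add: card_cartesian_product m_def)
  also have "\<dots> \<le> M * (\<Sum>c\<in>V. \<Sum>a\<in>V. real (f c a))" using M E by (intro mult_mono) auto
  also have "\<dots> < M * (\<Sum>c\<in>V. m ^ 3 / M)"
    using lt M fV V by (intro mult_strict_left_mono sum_strict_mono) auto
  also have "\<dots> = m * m ^ 3" using M by (simp add: m_def)
  finally show False by (simp add: power2_eq_square power3_eq_cube)
qed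

lemma multiplicative_vs_additive:
  fixes M \<sigma> \<Delta> \<delta> H :: real
  assumes V: "V \<subseteq> F - {0}" "V \<noteq> {}" and small: "(card V)\<^sup>2 \<le> card F"
    and M: "M > 0" "card (ims (*) V V) \<le> M"
    and \<sigma>: "\<sigma> > 0" "card (ims (-) V V) \<le> \<sigma> * card V"
    and P: "finite P" "card P \<le> \<Delta>"
    and deg1: "\<And>v. v \<in> V \<Longrightarrow> card {w \<in> V. v - w \<notin> P} \<le> \<delta> * card V"
    and deg2: "\<And>v. v \<in> V \<Longrightarrow> card {w \<in> V. w - v \<notin> P} \<le> \<delta> * card V"
    and H: "H = (\<Sum>j = 1..card V. 1 / real j)" and \<delta>: "\<delta> \<ge> 0" "256 * \<delta>\<^sup>2 * M * H \<le> card V"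
  shows "real (card V) ^ 9 \<le> 2 ^ 26 * M ^ 4 * H ^ 4 * \<sigma> ^ 5 * \<Delta> ^ 4"
proof -
  define m where "m = real (card V)"
  have VF: "V \<subseteq> F" using V by blast
  have fV: "finite V" using VF finite_sub_F by blast
  have m1: "card V \<ge> 1" using V fV by (simp add: card_gt_0_iff Suc_le_eq)
  then have m: "m \<ge> 1" by (simp add: m_def)
  have H0: "H > 0" unfolding H using m1 by (intro sum_pos) auto
  have \<Delta>0: "\<Delta> \<ge> 0" using P(2) by linarith
  obtain c0 where c0: "c0 \<in> V" and Sle: "m ^ 3 / M \<le> (\<Sum>a\<in>V. card {x \<in> V. a * x \<in> (*) c0 ` V})"
    using exists_popular_dilate[OF V M] unfolding m_def by blast
  define W where "W a = {x \<in> V. a * x \<in> (*) c0 ` V}" for a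
  define S where "S = m ^ 3 / M"
  have S0: "S > 0" using m M by (simp add: S_def)
  have WV: "W a \<subseteq> V" and fW: "finite (W a)" for a using fV by (auto simp: W_def)
  have "\<exists>t\<in>{1..card V}. S \<le> (\<Sum>j = 1..card V. 1 / real j) * (real t * real (card {a \<in> V. t \<le> card (W a)}))"
    by (rule popular_level[OF fV _ S0]) (use Sle card_mono[OF fV WV] in \<open>auto simp: S_def W_def\<close>)
  then obtain t where t: "1 \<le> t" "t \<le> card V" and St: "S \<le> H * (real t * real (card {a \<in> V. t \<le> card (W a)}))"
    unfolding H by auto
  define V1 where "V1 = {a \<in> V. t \<le> card (W a)}"
  define n where "n = real (card V1)"
  have V1V: "V1 \<subseteq> V" by (auto simp: V1_def)
  have fV1: "finite V1" using V1V fV finite_subset by blast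
  have St: "S / H \<le> t * n" using St H0 by (simp add: V1_def n_def field_simps)
  have nm: "n \<le> m" using card_mono[OF fV V1V] by (simp add: n_def m_def)
  have SH: "S / H > 0" using S0 H0 by simp
  then have "t * n > 0" using St by linarith
  then have n0: "n > 0" and t0: "real t > 0" using t by (auto simp: zero_less_mult_iff)
  have W_ge: "t \<le> card (W a)" if "a \<in> V1" for a using that by (simp add: V1_def)
  have bad: "16 * card {(x, w). x \<in> V1 \<and> w \<in> W a \<and> x - w \<notin> P} \<le> card V1 * card (W a)" if a: "a \<in> V1" for a
  proof -
    have "(16 * \<delta> * m)\<^sup>2 \<le> t * n"
    proof -
      have "256 * \<delta>\<^sup>2 * M * H * m\<^sup>2 \<le> m * m\<^sup>2" using \<delta>(2) by (intro mult_right_mono) (auto simp: m_def)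
      then have "(16 * \<delta> * m)\<^sup>2 * (M * H) \<le> m ^ 3" by (simp add: power2_eq_square power3_eq_cube mult_ac)
      then have "(16 * \<delta> * m)\<^sup>2 \<le> S / H" using M H0 by (simp add: S_def field_simps)
      then show ?thesis using St by linarith
    qed
    then have or: "16 * \<delta> * m \<le> t \<or> 16 * \<delta> * m \<le> n"
    proof (rule contrapos_pp)
      assume "\<not> ?thesis"
      then have "t * n < (16 * \<delta> * m) * (16 * \<delta> * m)" using n0 t0 by (intro mult_strict_mono) auto
      then show "\<not> (16 * \<delta> * m)\<^sup>2 \<le> t * n" by (simp add: power2_eq_square)
    qed
    let ?B = "{(x, w). x \<in> V1 \<and> w \<in> W a \<and> x - w \<notin> P}"
    have B1: "?B = (SIGMA x:V1. {w \<in> W a. x - w \<notin> P})" by auto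
    have "?B = prod.swap ` (SIGMA w:W a. {x \<in> V1. x - w \<notin> P})" by force
    then have "card ?B = card (SIGMA w:W a. {x \<in> V1. x - w \<notin> P})" by (simp add: card_image)
    then have B2: "real (card ?B) = (\<Sum>w\<in>W a. real (card {x \<in> V1. x - w \<notin> P}))" using fV1 fW by simp
    have "(\<Sum>w\<in>W a. real (card {x \<in> V1. x - w \<notin> P})) \<le> (\<Sum>w\<in>W a. \<delta> * m)"
    proof (rule sum_mono)
      fix w assume w: "w \<in> W a"
      have "card {x \<in> V1. x - w \<notin> P} \<le> card {x \<in> V. x - w \<notin> P}" using fV V1V by (intro card_mono) auto
      then show "real (card {x \<in> V1. x - w \<notin> P}) \<le> \<delta> * m" using deg2[of w] w WV unfolding m_def by fastforce
    qed
    then have le2: "card ?B \<le> card (W a) * (\<delta> * m)" using B2 by simp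
    have "(\<Sum>x\<in>V1. real (card {w \<in> W a. x - w \<notin> P})) \<le> (\<Sum>x\<in>V1. \<delta> * m)"
    proof (rule sum_mono)
      fix x assume x: "x \<in> V1"
      have "card {w \<in> W a. x - w \<notin> P} \<le> card {w \<in> V. x - w \<notin> P}" using fV WV by (intro card_mono) auto
      then show "real (card {w \<in> W a. x - w \<notin> P}) \<le> \<delta> * m" using deg1[of x] x V1V unfolding m_def by fastforce
    qed
    then have le1: "card ?B \<le> n * (\<delta> * m)" using B1 fV1 fW by (simp add: n_def)
    from or have "16 * real (card ?B) \<le> n * card (W a)"
    proof
      assume "16 * \<delta> * m \<le> t"
      then have "n * (16 * \<delta> * m) \<le> n * card (W a)" using W_ge[OF a] n0 by (intro mult_left_mono) auto
      then show ?thesis using le1 by (simp add: algebra_simps)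
    next
      assume "16 * \<delta> * m \<le> n"
      then have "card (W a) * (16 * \<delta> * m) \<le> card (W a) * n" by (intro mult_left_mono) auto
      then show ?thesis using le2 by (simp add: algebra_simps)
    qed
    then show ?thesis by (simp add: n_def flip: of_nat_mult)
  qed
  have "\<exists>Z\<subseteq>P. card Z * card (W a) \<le> 16 * card P \<and> 8 * card (V1 - ims (+) Z (W a)) \<le> card V1" if "a \<in> V1" for a
    by (rule greedy_covering[OF fV1 fW _ P(1) bad[OF that]]) (use W_ge[OF that] t in auto)
  then obtain Z where Z: "\<And>a. a \<in> V1 \<Longrightarrow> Z a \<subseteq> P" "\<And>a. a \<in> V1 \<Longrightarrow> card (Z a) * card (W a) \<le> 16 * card P"
    "\<And>a. a \<in> V1 \<Longrightarrow> 8 * card (V1 - ims (+) (Z a) (W a)) \<le> card V1" by metis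
  have fZ: "finite (Z a)" if "a \<in> V1" for a using Z(1)[OF that] P(1) by (rule finite_subset)
  have Zle: "real (card (Z a)) \<le> 16 * \<Delta> / t" if "a \<in> V1" for a
  proof -
    have "card (Z a) * t \<le> card (Z a) * card (W a)" using W_ge[OF that] by simp
    then have "real (card (Z a) * t) \<le> real (16 * card P)" using Z(2)[OF that] by (intro of_nat_mono) linarith
    then have "real (card (Z a)) * t \<le> 16 * \<Delta>" using P(2) by simp
    then show ?thesis using t0 by (simp add: field_simps)
  qed
  have \<sigma>1: "\<sigma> \<ge> 1"
  proof -
    have "card V = card ((\<lambda>x. x - c0) ` V)" by (rule card_image[symmetric]) (auto intro: inj_onI)
    also have "\<dots> \<le> card (ims (-) V V)" using fV c0 by (intro card_mono) (auto intro: imsI)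
    finally have "1 * m \<le> \<sigma> * m" using \<sigma>(2) by (simp add: m_def)
    then show ?thesis using m by simp
  qed
  have key: "n ^ 3 * t ^ 4 \<le> 2 ^ 26 * \<sigma> ^ 5 * \<Delta> ^ 4 * m\<^sup>2"
  proof (cases "card V1 \<ge> 2")
    case True
    have V1F: "V1 \<subseteq> F" using V1V VF by blast
    have "(card V1)\<^sup>2 \<le> (card V)\<^sup>2" using card_mono[OF fV V1V] by (rule power_mono) simp
    then have "(card V1)\<^sup>2 \<le> card F" using small by linarith
    from pivot[OF V1F True this] obtain a b c d \<xi> where abcd: "a \<in> V1" "b \<in> V1" "c \<in> V1" "d \<in> V1" "c \<noteq> d"
      and \<xi>: "\<xi> \<in> F" "\<xi> * (c - d) = a - b"
      and pv: "\<And>X Y. X \<subseteq> V1 \<Longrightarrow> Y \<subseteq> V1 \<Longrightarrow> 3 * card V1 \<le> 4 * card X \<Longrightarrow> 3 * card V1 \<le> 4 * card Y \<Longrightarrow>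
      real (card V1) ^ 3 \<le> 64 * real (card (ims (-) V1 V1)) * real (card (ims (-) X ((*) \<xi> ` Y)))" by metis
    define G where "G a b = V1 - ((V1 - ims (+) (Z a) (W a)) \<union> (V1 - ims (+) (Z b) (W b)))" for a b
    have G: "3 * card V1 \<le> 4 * card (G a b)" if "a \<in> V1" "b \<in> V1" for a b
    proof -
      have "card V1 - card ((V1 - ims (+) (Z a) (W a)) \<union> (V1 - ims (+) (Z b) (W b))) \<le> card (G a b)"
        unfolding G_def by (rule diff_card_le_card_Diff) (use fV1 in auto)
      moreover have "card ((V1 - ims (+) (Z a) (W a)) \<union> (V1 - ims (+) (Z b) (W b)))
        \<le> card (V1 - ims (+) (Z a) (W a)) + card (V1 - ims (+) (Z b) (W b))" by (rule card_Un_le)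
      ultimately show ?thesis using Z(3)[OF that(1)] Z(3)[OF that(2)] by linarith
    qed
    have GV1: "G a b \<subseteq> V1" and GW: "G a b \<subseteq> ims (+) (Z a) (W a)" "G a b \<subseteq> ims (+) (Z b) (W b)" for a b
      by (auto simp: G_def)
    let ?T = "card (ims (-) (G c d) ((*) \<xi> ` G a b))"
    let ?D = "card (ims (-) (ims (+) V V) (ims (+) V V))"
    have F: "a \<in> F" "b \<in> F" "c \<in> F" "d \<in> F" "c0 \<in> F" using abcd V1F c0 VF by auto
    have "?T \<le> card (Z a) * card (Z b) * card (Z c) * card (Z d) * ?D"
      by (rule dilate_difference_le[OF VF F(5) F(1-4) abcd(5) \<xi>])
        (use GV1 V1F GW fZ abcd in \<open>auto simp: W_def[symmetric]\<close>)
    then have "real ?T \<le> real (card (Z a)) * card (Z b) * card (Z c) * card (Z d) * ?D"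
      by (simp flip: of_nat_mult)
    also have "\<dots> \<le> (16 * \<Delta> / t) * (16 * \<Delta> / t) * (16 * \<Delta> / t) * (16 * \<Delta> / t) * (16 * \<sigma> ^ 4 * m)"
      using Zle abcd card_double_difference_le[OF fV V(2) \<sigma>] \<Delta>0 by (intro mult_mono) (auto simp: m_def)
    finally have T: "real ?T \<le> (16 * \<Delta> / t) ^ 4 * (16 * \<sigma> ^ 4 * m)" by (simp add: power4_eq_xxxx)
    have "n ^ 3 \<le> 64 * real (card (ims (-) V1 V1)) * real ?T"
      unfolding n_def using abcd by (intro pv GV1 G)
    also have "\<dots> \<le> 64 * (\<sigma> * m) * ((16 * \<Delta> / t) ^ 4 * (16 * \<sigma> ^ 4 * m))"
    proof (intro mult_mono T order.refl)
      have "card (ims (-) V1 V1) \<le> card (ims (-) V V)" using fV V1V by (intro card_mono ims_mono) auto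
      then show "real (card (ims (-) V1 V1)) \<le> \<sigma> * m" using \<sigma>(2) by (simp add: m_def)
    qed (use \<sigma> m in auto)
    also have "\<dots> = 2 ^ 26 * \<sigma> ^ 5 * \<Delta> ^ 4 * m\<^sup>2 / t ^ 4"
      by (simp add: power_divide power_mult_distrib power2_eq_square power_numeral_reduce)
    finally show ?thesis using t0 by (simp add: field_simps)
  next
    case False
    then have "card V1 = 1" using n0 by (simp add: n_def)
    then have n1: "n = 1" by (simp add: n_def)
    obtain a where a: "a \<in> V1" using n0 by (force simp: n_def)
    have "card (Z a) \<noteq> 0"
    proof
      assume "card (Z a) = 0"
      then have "Z a = {}" using fZ[OF a] by simp
      then show False using Z(3)[OF a] \<open>card V1 = 1\<close> by simp
    qed
    then have "1 \<le> 16 * \<Delta> / t" using Zle[OF a] by linarith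
    then have "real t \<le> 16 * \<Delta>" using t0 by (simp add: field_simps)
    then have "real t ^ 4 \<le> (16 * \<Delta>) ^ 4" by (intro power_mono) auto
    also have "\<dots> = 2 ^ 16 * 1 * \<Delta> ^ 4 * 1" by (simp add: power_mult_distrib)
    also have "\<dots> \<le> 2 ^ 26 * \<sigma> ^ 5 * \<Delta> ^ 4 * m\<^sup>2"
      using \<sigma>1 m \<Delta>0 by (intro mult_mono one_le_power) auto
    finally show ?thesis using n1 by simp
  qed
  define s where "s = S / H"
  have s: "s > 0" "s \<le> t * n" using SH St by (simp_all add: s_def)
  have "s \<le> t * m" using s(2) nm t0 by (meson mult_left_mono order_trans less_imp_le)
  then have tm: "s / m \<le> t" using m by (subst pos_divide_le_eq) auto
  have "s ^ 3 * (s / m) \<le> (t * n) ^ 3 * t"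
    using s tm t0 n0 m by (intro mult_mono power_mono) auto
  also have "\<dots> = n ^ 3 * t ^ 4" by (simp add: power_mult_distrib power_numeral_reduce)
  also note key
  finally have "s ^ 4 \<le> 2 ^ 26 * \<sigma> ^ 5 * \<Delta> ^ 4 * m\<^sup>2 * m"
    using m by (simp add: pos_divide_le_eq power_numeral_reduce mult_ac)
  moreover have "s ^ 4 * (M ^ 4 * H ^ 4) = m ^ 12"
    using M H0 by (simp add: s_def S_def power_divide power_mult_distrib flip: power_mult)
  ultimately have "m ^ 12 \<le> (2 ^ 26 * \<sigma> ^ 5 * \<Delta> ^ 4 * m\<^sup>2 * m) * (M ^ 4 * H ^ 4)"
    using M H0 by (metis mult_right_mono mult_nonneg_nonneg zero_le_power less_imp_le)
  then have "m ^ 3 * m ^ 9 \<le> m ^ 3 * (2 ^ 26 * M ^ 4 * H ^ 4 * \<sigma> ^ 5 * \<Delta> ^ 4)"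
    by (simp add: power_numeral_reduce mult_ac)
  then have "m ^ 9 \<le> 2 ^ 26 * M ^ 4 * H ^ 4 * \<sigma> ^ 5 * \<Delta> ^ 4" by (rule mult_left_le_imp_le) (use m in simp)
  then show ?thesis by (simp add: m_def)
qed

end

lemma (in prime_subfield) growth_of_shifted_product:
  fixes K H :: real
  assumes A: "A \<subseteq> F" "0 \<notin> A" "\<And>a. a \<in> A \<Longrightarrow> a + e \<noteq> 0" "A \<noteq> {}" and small: "(card A)\<^sup>2 \<le> card F"
    and K: "K > 0" "card (ims (*) A ((\<lambda>a. a + e) ` A)) \<le> K * card A"
    and H: "H = (\<Sum>j = 1..card A. 1 / real j)"
  shows "card A \<le> 2 ^ 237 * K ^ 103 * H ^ 6"
proof -
  define N where "N = real (card A)"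
  have fA: "finite A" using A finite_sub_F by blast
  have N1: "card A \<ge> 1" using A fA by (simp add: card_gt_0_iff Suc_le_eq)
  have N: "N \<ge> 1" using N1 by (simp add: N_def)
  have H0: "H > 0" unfolding H using N1 by (intro sum_pos) auto
  have cB: "card ((\<lambda>a. a + e) ` A) = card A" by (rule card_image) (auto intro: inj_onI)
  have AA: "card (ims (*) A A) \<le> 4 * K\<^sup>2 * card A"
    by (rule card_prodset_self_le[OF _ _ _ cB K]) (use A add_F e_F in auto)
  define q where "q = sqrt (K ^ 3 * H)"
  have q0: "q > 0" using K H0 by (simp add: q_def)
  have q2: "q\<^sup>2 = K ^ 3 * H" using K H0 by (simp add: q_def)
  define l where "l = 1 / (2048 * q)"
  have l: "l > 0" using q0 by (simp add: l_def)
  obtain V P where V: "V \<subseteq> A" and NV: "card A \<le> 4 * K * card V"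
    and VV: "card (ims (-) V V) \<le> 2 ^ 25 * K ^ 12 * card V"
    and P: "finite P" "card P \<le> 16 * K ^ 5 * card A / l"
    and deg: "\<forall>v\<in>V. card {w \<in> V. v - w \<notin> P} \<le> 32 * l * card V \<and> card {w \<in> V. w - v \<notin> P} \<le> 32 * l * card V"
    using additive_structure[OF A K AA l] by blast
  define m where "m = real (card V)"
  have fV: "finite V" using V fA finite_subset by blast
  have Nm: "N \<le> 4 * K * m" using NV by (simp add: N_def m_def)
  then have m0: "m > 0" using N K by (metis less_le_trans m_def mult_zero_right not_one_le_zero of_nat_0_le_iff order_less_le)
  have Vne: "V \<noteq> {}" using m0 by (auto simp: m_def)
  define h where "h = (\<Sum>j = 1..card V. 1 / real j)"
  have h: "h \<ge> 0" "h \<le> H" unfolding h_def H using card_mono[OF fA V] by (auto intro!: sum_nonneg sum_mono2)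
  define M where "M = 4 * K\<^sup>2 * N"
  have M0: "M > 0" using K N by (simp add: M_def)
  have "card (ims (*) V V) \<le> card (ims (*) A A)" using fA V by (intro card_mono ims_mono) auto
  then have VM: "card (ims (*) V V) \<le> M" using AA by (simp add: M_def N_def)
  have Mm: "M \<le> 16 * K ^ 3 * m"
  proof -
    have "M \<le> 4 * K\<^sup>2 * (4 * K * m)" unfolding M_def using Nm K by (intro mult_left_mono) auto
    then show ?thesis by (simp add: power2_eq_square power3_eq_cube)
  qed
  have d: "256 * (32 * l)\<^sup>2 * M * h \<le> m"
  proof -
    have "256 * (32 * l)\<^sup>2 * M * h \<le> 256 * (32 * l)\<^sup>2 * (16 * K ^ 3 * m) * H"
      using Mm h M0 K m0 by (intro mult_mono) auto
    also have "\<dots> = 16 * 256 * 1024 * l\<^sup>2 * q\<^sup>2 * m" by (simp add: q2 power_mult_distrib)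
    also have "\<dots> = m" using q0 by (simp add: l_def power2_eq_square)
    finally show ?thesis .
  qed
  have small': "(card V)\<^sup>2 \<le> card F"
    using power_mono[OF card_mono[OF fA V], of 2] small by linarith
  have VF: "V \<subseteq> F - {0}" using V A by blast
  have main: "m ^ 9 \<le> 2 ^ 26 * M ^ 4 * h ^ 4 * (2 ^ 25 * K ^ 12) ^ 5 * (16 * K ^ 5 * N / l) ^ 4"
    unfolding m_def
    by (rule multiplicative_vs_additive[OF VF Vne small' M0 VM _ VV P(1) _ _ _ h_def _ d[unfolded m_def]])
      (use P(2) deg K l in \<open>auto simp: N_def\<close>)
  have D: "16 * K ^ 5 * N / l \<le> 2 ^ 17 * K ^ 6 * m * q"
  proof -
    have "16 * K ^ 5 * N / l = 2 ^ 15 * K ^ 5 * q * N" by (simp add: l_def)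
    also have "\<dots> \<le> 2 ^ 15 * K ^ 5 * q * (4 * K * m)" using Nm K q0 by (intro mult_left_mono) auto
    also have "\<dots> = 2 ^ 17 * K ^ 6 * m * q" by (simp add: power_numeral_reduce)
    finally show ?thesis .
  qed
  have "2 ^ 26 * M ^ 4 * h ^ 4 * (2 ^ 25 * K ^ 12) ^ 5 * (16 * K ^ 5 * N / l) ^ 4
    \<le> 2 ^ 26 * (16 * K ^ 3 * m) ^ 4 * H ^ 4 * (2 ^ 25 * K ^ 12) ^ 5 * (2 ^ 17 * K ^ 6 * m * q) ^ 4"
    using M0 Mm h H0 D K l N m0 by (intro mult_mono power_mono) auto
  also have "\<dots> = 2 ^ 235 * (K ^ 12 * K ^ 60 * K ^ 24) * (m ^ 4 * m ^ 4) * H ^ 4 * (q\<^sup>2)\<^sup>2"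
    by (simp add: power_mult_distrib mult_ac flip: power_mult)
  also have "\<dots> = m ^ 8 * (2 ^ 235 * K ^ 102 * H ^ 6)"
    by (simp add: q2 power_mult_distrib mult_ac flip: power_mult power_add)
  finally have "m ^ 8 * m \<le> m ^ 8 * (2 ^ 235 * K ^ 102 * H ^ 6)"
    using main by (simp add: power_numeral_reduce mult_ac)
  then have "m \<le> 2 ^ 235 * K ^ 102 * H ^ 6" by (rule mult_left_le_imp_le) (use m0 in simp)
  then have "4 * K * m \<le> 4 * K * (2 ^ 235 * K ^ 102 * H ^ 6)" using K by (intro mult_left_mono) auto
  also have "\<dots> = 2 ^ 237 * K ^ 103 * H ^ 6" by (simp add: power_numeral_reduce)
  finally have "4 * K * m \<le> 2 ^ 237 * K ^ 103 * H ^ 6" .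
  with Nm show ?thesis unfolding N_def by (rule order_trans)
qed

subsection \<open>Prime fields inside a single ring\<close>

text \<open>Families of residues modulo every \<open>n\<close> at once; the component at \<open>n = 0\<close> is an arbitrary integer
  because \<open>x mod 0 = x\<close>. The field of \<open>p\<close> elements is the set of families supported at \<open>p\<close>.\<close>

typedef residue_family = "{x :: nat \<Rightarrow> int. \<forall>n. x n mod int n = x n}"
  by (rule exI[of _ "\<lambda>_. 0"]) simp

setup_lifting type_definition_residue_family

instantiation residue_family :: comm_ring
begin

lift_definition zero_residue_family :: residue_family is "\<lambda>_. 0" by simp
lift_definition plus_residue_family :: "residue_family \<Rightarrow> residue_family \<Rightarrow> residue_family"
  is "\<lambda>x y n. (x n + y n) mod int n" by simp
lift_definition minus_residue_family :: "residue_family \<Rightarrow> residue_family \<Rightarrow> residue_family"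
  is "\<lambda>x y n. (x n - y n) mod int n" by simp
lift_definition uminus_residue_family :: "residue_family \<Rightarrow> residue_family"
  is "\<lambda>x n. (- x n) mod int n" by simp
lift_definition times_residue_family :: "residue_family \<Rightarrow> residue_family \<Rightarrow> residue_family"
  is "\<lambda>x y n. (x n * y n) mod int n" by simp

instance
  by standard (transfer; force simp: fun_eq_iff mod_simps algebra_simps)+

end

lift_definition residue_at :: "nat \<Rightarrow> int \<Rightarrow> residue_family"
  is "\<lambda>p x n. if n = p then x mod int n else 0" by simp

lemma residue_at_arith:
  "residue_at p x + residue_at p y = residue_at p (x + y)"
  "residue_at p x - residue_at p y = residue_at p (x - y)"
  "residue_at p x * residue_at p y = residue_at p (x * y)"
  "residue_at p 0 = 0"
  by (transfer; force simp: fun_eq_iff mod_simps)+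

lemma residue_at_eq_iff: "residue_at p x = residue_at p y \<longleftrightarrow> x mod int p = y mod int p"
  by transfer (auto simp: fun_eq_iff)

lemma residue_at_mod: "residue_at p (x mod int p) = residue_at p x"
  by (simp add: residue_at_eq_iff)

lemma inj_on_residue_at: "inj_on (residue_at p) {0..<int p}"
  by (rule inj_onI) (simp add: residue_at_eq_iff)

lemma range_residue_at: "p > 0 \<Longrightarrow> range (residue_at p) = residue_at p ` {0..<int p}"
  by (auto simp: image_iff) (metis residue_at_mod atLeastLessThan_iff of_nat_0_less_iff pos_mod_bound pos_mod_sign)

lemma card_range_residue_at: "p > 0 \<Longrightarrow> card (range (residue_at p)) = p"
  by (simp add: range_residue_at card_image inj_on_residue_at)

lemma prime_subfield_residue_at:
  assumes "prime p"
  shows "prime_subfield (range (residue_at p)) (residue_at p 1)"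
proof
  have p: "p > 1" using assms prime_gt_1_nat by blast
  show "finite (range (residue_at p))" using p by (simp add: range_residue_at)
  show "0 \<in> range (residue_at p)" by (metis rangeI residue_at_arith(4))
  show "residue_at p 1 \<in> range (residue_at p)" by simp
  show "residue_at p 1 \<noteq> 0" unfolding residue_at_arith(4)[of p, symmetric] residue_at_eq_iff using p by simp
  show "x + y \<in> range (residue_at p)" "x - y \<in> range (residue_at p)" "x * y \<in> range (residue_at p)"
    if "x \<in> range (residue_at p)" "y \<in> range (residue_at p)" for x y
    using that by (auto simp: residue_at_arith)
  show "residue_at p 1 * x = x" if "x \<in> range (residue_at p)" for x
    using that by (auto simp: residue_at_arith)
  show "\<exists>y\<in>range (residue_at p). x * y = residue_at p 1" if "x \<in> range (residue_at p)" "x \<noteq> 0" for x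
  proof -
    obtain k where k: "x = residue_at p k" using \<open>x \<in> range (residue_at p)\<close> by blast
    have "k mod int p \<noteq> 0" using \<open>x \<noteq> 0\<close> unfolding k residue_at_arith(4)[of p, symmetric] residue_at_eq_iff by simp
    then have "\<not> int p dvd k" by (simp add: dvd_eq_mod_eq_0)
    then have "coprime k (int p)" using assms by (metis coprime_commute prime_imp_coprime prime_nat_int_transfer)
    then obtain y where "[k * y = 1] (mod int p)" using cong_solve_coprime_int by blast
    then have "x * residue_at p y = residue_at p 1" by (simp add: k residue_at_arith residue_at_eq_iff Cong.cong_def)
    then show ?thesis by blast
  qed
  show "range (residue_at p) \<subseteq> R" if "0 \<in> R" "\<And>x. x \<in> R \<Longrightarrow> x + residue_at p 1 \<in> R" for R
  proof -
    have nat: "residue_at p (int n) \<in> R" for n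
    proof (induction n)
      case 0 then show ?case using that(1) by (simp add: residue_at_arith)
    next
      case (Suc n)
      then have "residue_at p (int n) + residue_at p 1 \<in> R" by (rule that(2))
      then show ?case by (simp add: residue_at_arith add.commute)
    qed
    have "residue_at p k \<in> R" for k
    proof -
      have "residue_at p k = residue_at p (int (nat (k mod int p)))" using p by (simp add: residue_at_mod)
      then show ?thesis using nat by (simp only:)
    qed
    then show ?thesis by blast
  qed
qed

lemma shifted_product_eq:
  "A <#>\<^bsub>\<F> p\<^esub> (A +>\<^bsub>\<F> p\<^esub> \<one>\<^bsub>\<F> p\<^esub>) = {(a * ((b + 1) mod int p)) mod int p |a b. a \<in> A \<and> b \<in> A}"
  by (auto simp: set_mult_def a_r_coset_def' residue_ring_def)

lemma harmonic_sum_le: "n > 0 \<Longrightarrow> (\<Sum>j = 1..n. 1 / real j) \<le> 1 + ln (real n)"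
proof (induction n rule: nat_induct_non_zero)
  case (Suc n)
  have "ln (real n / real (Suc n)) \<le> real n / real (Suc n) - 1" using Suc.hyps by (intro ln_le_minus_one) simp
  also have "\<dots> = - 1 / real (Suc n)" by (simp add: field_simps)
  finally have "1 / real (Suc n) \<le> ln (real (Suc n)) - ln (real n)" using Suc.hyps by (simp add: ln_div)
  then show ?case using Suc.IH by simp
qed simp

lemma card_shifted_product:
  fixes A :: "int set"
  assumes p: "prime p" and A: "A \<subseteq> carrier (\<F> p)" and small: "real (card A) < real p powr (1 / 2)" and big: "card A > 2"
  defines "C \<equiv> A <#>\<^bsub>\<F> p\<^esub> (A +>\<^bsub>\<F> p\<^esub> \<one>\<^bsub>\<F> p\<^esub>)"
  shows "(real (card A) - 2) ^ 104 \<le> 2 ^ 237 * real (card C) ^ 103 * (1 + ln (real (card A))) ^ 6"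
proof -
  have p1: "p > 1" using p prime_gt_1_nat by blast
  interpret prime_subfield "range (residue_at p)" "residue_at p 1" by (rule prime_subfield_residue_at[OF p])
  have A0: "A \<subseteq> {0..<int p}" using A by (auto simp: residue_ring_def)
  have fA: "finite A" using A0 finite_subset by blast
  define B where "B = A - {0, int p - 1}"
  have fB: "finite B" and BA: "B \<subseteq> A" using fA by (auto simp: B_def)
  define n where "n = real (card B)"
  have "card A - card {0, int p - 1} \<le> card B" unfolding B_def by (rule diff_card_le_card_Diff) simp
  moreover have "card {0, int p - 1} \<le> 2" by (simp add: card_insert_if)
  ultimately have nA: "card A - 2 \<le> card B" by linarith
  have n0: "n > 0" and nA: "real (card A) - 2 \<le> n" using nA big by (simp_all add: n_def)
  have cBA: "card B \<le> card A" by (rule card_mono[OF fA BA])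
  define R where "R = residue_at p ` B"
  have cR: "card R = card B"
    unfolding R_def using A0 BA by (intro card_image inj_on_subset[OF inj_on_residue_at]) auto
  have fC: "finite C"
  proof -
    have "C = (\<lambda>(a, b). (a * ((b + 1) mod int p)) mod int p) ` (A \<times> A)" by (auto simp: C_def shifted_product_eq)
    then show ?thesis using fA by simp
  qed
  have "ims (*) R ((\<lambda>a. a + residue_at p 1) ` R) \<subseteq> residue_at p ` C"
  proof
    fix z assume "z \<in> ims (*) R ((\<lambda>a. a + residue_at p 1) ` R)"
    then obtain a b where ab: "a \<in> B" "b \<in> B" "z = residue_at p a * (residue_at p b + residue_at p 1)"
      by (auto simp: R_def elim!: imsE)
    have "z = residue_at p ((a * ((b + 1) mod int p)) mod int p)"
      unfolding ab(3) residue_at_arith residue_at_eq_iff by (simp add: mod_simps)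
    moreover have "(a * ((b + 1) mod int p)) mod int p \<in> C" using ab BA by (auto simp: C_def shifted_product_eq)
    ultimately show "z \<in> residue_at p ` C" by blast
  qed
  then have cC: "card (ims (*) R ((\<lambda>a. a + residue_at p 1) ` R)) \<le> card C"
    using fC by (meson card_image_le card_mono finite_imageI order_trans)
  have Rne: "R \<noteq> {}" using n0 by (auto simp: R_def n_def)
  then have "ims (*) R ((\<lambda>a. a + residue_at p 1) ` R) \<noteq> {}" by (auto simp: ims_def)
  then have "card (ims (*) R ((\<lambda>a. a + residue_at p 1) ` R)) > 0" using fB by (simp add: card_gt_0_iff R_def)
  then have C0: "real (card C) > 0" using cC by linarith
  define K where "K = real (card C) / n"
  have K0: "K > 0" using C0 n0 by (simp add: K_def)
  have KR: "card (ims (*) R ((\<lambda>a. a + residue_at p 1) ` R)) \<le> K * card R"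
    using cC n0 by (simp add: K_def cR n_def)
  have smallR: "(card R)\<^sup>2 \<le> card (range (residue_at p))"
  proof -
    have "(real (card B))\<^sup>2 \<le> (real p powr (1 / 2))\<^sup>2" using small cBA by (intro power_mono) auto
    also have "\<dots> = p" by (simp add: powr_half_sqrt)
    finally show ?thesis using p1 by (simp add: cR card_range_residue_at flip: of_nat_power)
  qed
  have R0: "0 \<notin> R"
    unfolding R_def residue_at_arith(4)[of p, symmetric] using A0 by (auto simp: B_def residue_at_eq_iff)
  have R1: "r + residue_at p 1 \<noteq> 0" if r: "r \<in> R" for r
  proof -
    obtain b where b: "b \<in> B" "r = residue_at p b" using r by (auto simp: R_def)
    then have "b \<in> A" "b \<noteq> int p - 1" by (simp_all add: B_def)
    moreover from \<open>b \<in> A\<close> have "0 \<le> b" "b < int p" using A0 by auto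
    ultimately have "0 < b + 1" "b + 1 < int p" by linarith+
    then have "residue_at p (b + 1) \<noteq> residue_at p 0" by (simp add: residue_at_eq_iff)
    then show ?thesis unfolding b(2) by (simp add: residue_at_arith)
  qed
  define H where "H = (\<Sum>j = 1..card R. 1 / real j)"
  have RF: "R \<subseteq> range (residue_at p)" by (auto simp: R_def)
  have "n \<le> 2 ^ 237 * K ^ 103 * H ^ 6"
    unfolding n_def cR[symmetric] by (rule growth_of_shifted_product[OF RF R0 R1 Rne smallR K0 KR H_def])
  also have "\<dots> \<le> 2 ^ 237 * K ^ 103 * (1 + ln (real (card A))) ^ 6"
  proof (intro mult_left_mono power_mono)
    have "H \<le> 1 + ln (real (card B))" unfolding H_def cR using n0 by (intro harmonic_sum_le) (simp add: n_def)
    also have "\<dots> \<le> 1 + ln (real (card A))" using cBA n0 by (simp add: n_def)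
    finally show "H \<le> 1 + ln (real (card A))" .
    show "0 \<le> H" by (simp add: H_def sum_nonneg)
  qed (use K0 in auto)
  finally have "n * n ^ 103 \<le> 2 ^ 237 * K ^ 103 * (1 + ln (real (card A))) ^ 6 * n ^ 103"
    using n0 by (intro mult_right_mono) auto
  also have "\<dots> = 2 ^ 237 * real (card C) ^ 103 * (1 + ln (real (card A))) ^ 6"
    using n0 by (simp add: K_def power_divide)
  finally have "n ^ 104 \<le> 2 ^ 237 * real (card C) ^ 103 * (1 + ln (real (card A))) ^ 6"
    by (simp flip: power_Suc)
  moreover have "(real (card A) - 2) ^ 104 \<le> n ^ 104" using nA big by (intro power_mono) auto
  ultimately show ?thesis by linarith
qed

theorem theorem1:
  shows "\<exists>\<epsilon> :: nat \<Rightarrow> real. \<epsilon> \<longlonglongrightarrow> 0 \<and>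
    (\<forall>(p :: nat) (A :: int set).
      prime p \<longrightarrow> A \<subseteq> carrier (\<F> p) \<longrightarrow> A \<noteq> {} \<longrightarrow>
      real (card A) < real p powr (1 / 2) \<longrightarrow>
      real (card (A <#>\<^bsub>\<F> p\<^esub> (A +>\<^bsub>\<F> p\<^esub> \<one>\<^bsub>\<F> p\<^esub>)))
        \<ge> real (card A) powr (106 / 105 + \<epsilon> (card A)))"
proof -
  have "eventually (\<lambda>n::nat. 2 ^ 237 * (real n powr (106 / 105)) ^ 103 * (1 + ln (real n)) ^ 6 < (real n - 2) ^ 104) at_top"
    by real_asymp
  then obtain n0 where n0: "\<And>n. n \<ge> n0 \<Longrightarrow>
      2 ^ 237 * (real n powr (106 / 105)) ^ 103 * (1 + ln (real n)) ^ 6 < (real n - 2) ^ 104"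
    unfolding eventually_sequentially by blast
  define \<epsilon> :: "nat \<Rightarrow> real" where "\<epsilon> n = (if n \<ge> max n0 3 then 0 else - 106 / 105)" for n
  have "\<epsilon> \<longlonglongrightarrow> 0"
    by (rule tendsto_eventually, rule eventually_sequentiallyI[of "max n0 3"]) (simp add: \<epsilon>_def)
  moreover have "real (card A) powr (106 / 105 + \<epsilon> (card A)) \<le> real (card (A <#>\<^bsub>\<F> p\<^esub> (A +>\<^bsub>\<F> p\<^esub> \<one>\<^bsub>\<F> p\<^esub>)))"
    if p: "prime p" and A: "A \<subseteq> carrier (\<F> p)" "A \<noteq> {}" and small: "real (card A) < real p powr (1 / 2)" for p and A :: "int set"
  proof -
    let ?C = "A <#>\<^bsub>\<F> p\<^esub> (A +>\<^bsub>\<F> p\<^esub> \<one>\<^bsub>\<F> p\<^esub>)"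
    have "finite A" using A(1) by (rule finite_subset) (simp add: residue_ring_def)
    then have cA: "card A > 0" using A by (simp add: card_gt_0_iff)
    show ?thesis
    proof (cases "card A \<ge> max n0 3")
      case True
      have "real (card A) powr (106 / 105) \<le> card ?C"
      proof (rule ccontr)
        assume "\<not> ?thesis"
        then have "real (card ?C) ^ 103 \<le> (real (card A) powr (106 / 105)) ^ 103" by (intro power_mono) auto
        then have "2 ^ 237 * real (card ?C) ^ 103 * (1 + ln (real (card A))) ^ 6
          \<le> 2 ^ 237 * (real (card A) powr (106 / 105)) ^ 103 * (1 + ln (real (card A))) ^ 6"
          by (intro mult_right_mono mult_left_mono) auto
        moreover have "(real (card A) - 2) ^ 104 \<le> 2 ^ 237 * real (card ?C) ^ 103 * (1 + ln (real (card A))) ^ 6"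
          using card_shifted_product[OF p A(1) small] True by simp
        ultimately show False using n0[of "card A"] True by linarith
      qed
      then show ?thesis using True by (simp add: \<epsilon>_def)
    next
      case False
      have "?C = (\<lambda>(a, b). (a * ((b + 1) mod int p)) mod int p) ` (A \<times> A)" by (auto simp: shifted_product_eq)
      then have "card ?C > 0" using \<open>finite A\<close> A(2) by (simp add: card_gt_0_iff)
      moreover have "\<epsilon> (card A) = - 106 / 105" using False by (simp only: \<epsilon>_def if_False)
      ultimately show ?thesis using cA by simp
    qed
  qed
  ultimately show ?thesis by blast
qed

end
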